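(* Let $m\ge2$ be an integer and let $G$ be a Cayley graph (with respect to any finite symmetric generating set not containing the identity) of the lamplighter group $\mathbb{Z}_m\wr\mathbb{Z}$. Let $N_0$ be the integrated density of states of the Laplacian $\Delta(G)$. Then there are positive constants $a_1^+,a_2^+$ such that $$N_0(E)\le a_1^+e^{-a_2^+E^{-1/2}}\quad\text{for all }E>0\text{ small enough},$$ and for every $r>1/2$ there are positive constants $a_{r,1}^-,a_{r,2}^-$ such that $$N_0(E)\ge a_{r,1}^-e^{-a_{r,2}^-E^{-r}}\quad\text{for all }E>0\text{ small enough}.$$
   Context: $\mathbb{Z}_m\wr\mathbb{Z}$ is the set of pairs $(\varphi,x)$ with $\varphi:\mathbb{Z}\to\mathbb{Z}_m$ finitely supported and $x\in\mathbb{Z}$, with product $(\varphi_1,x_1)(\varphi_2,x_2)=(\varphi_1+\varphi_2(\cdot-x_1),x_1+x_2)$. For a Cayley graph $G=(V,E)$ with generating set $S$, $k=|S|$, the Laplacian on $\ell^2(V)$ is $\Delta(G)=k\,\mathrm{Id}-A(G)$, $(A(G)\varphi)(x)=\sum_{y\sim x}\varphi(y)$, and $N_0(E)=\langle\chi_{(-\infty,E]}(\Delta(G))\delta_\iota,\delta_\iota\rangle$ with $\iota$ the identity. *)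

theory Defs
  imports "HOL-Analysis.Analysis"
begin

type_synonym lamp = "(int \<Rightarrow> int) \<times> int"

definition LL_carrier :: "int \<Rightarrow> lamp set" where
  "LL_carrier m = {(\<phi>, x). (\<forall>t. 0 \<le> \<phi> t \<and> \<phi> t < m) \<and> finite {t. \<phi> t \<noteq> 0}}"

definition LL_mult :: "int \<Rightarrow> lamp \<Rightarrow> lamp \<Rightarrow> lamp" where
  "LL_mult m a b = ((\<lambda>t. (fst a t + fst b (t - snd a)) mod m), snd a + snd b)"

definition LL_one :: lamp where
  "LL_one = ((\<lambda>_. 0), 0)"

definition LL_inv :: "int \<Rightarrow> lamp \<Rightarrow> lamp" where
  "LL_inv m a = ((\<lambda>t. (- fst a (t + snd a)) mod m), - snd a)"

inductive_set LL_gen :: "int \<Rightarrow> lamp set \<Rightarrow> lamp set" for m S where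
  one: "LL_one \<in> LL_gen m S"
| step: "g \<in> LL_gen m S \<Longrightarrow> s \<in> S \<Longrightarrow> LL_mult m g s \<in> LL_gen m S"

definition LL_lap :: "int \<Rightarrow> lamp set \<Rightarrow> (lamp \<Rightarrow> real) \<Rightarrow> lamp \<Rightarrow> real" where
  "LL_lap m S f g = real (card S) * f g - (\<Sum>s\<in>S. f (LL_mult m g s))"

definition LL_delta :: "lamp \<Rightarrow> real" where
  "LL_delta = (\<lambda>g. if g = LL_one then 1 else 0)"

definition LL_moment :: "int \<Rightarrow> lamp set \<Rightarrow> nat \<Rightarrow> real" where
  "LL_moment m S n = ((LL_lap m S ^^ n) LL_delta) LL_one"

text \<open>Spectral measure of delta_iota w.r.t. Delta: the unique finite Borel measure supported on
  [0, 2k] (which contains the spectrum of Delta) whose moments are <Delta^n delta, delta>.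
  N_0(E) = mu((-inf, E]) = <chi_{(-inf,E]}(Delta) delta, delta>.\<close>
definition LL_spec_measure :: "int \<Rightarrow> lamp set \<Rightarrow> real measure" where
  "LL_spec_measure m S = (THE \<mu>. sets \<mu> = sets borel \<and> finite_measure \<mu>
      \<and> emeasure \<mu> (- {0 .. 2 * real (card S)}) = 0
      \<and> (\<forall>n. integrable \<mu> (\<lambda>x. x ^ n) \<and> (\<integral>x. x ^ n \<partial>\<mu>) = LL_moment m S n))"

definition LL_IDS :: "int \<Rightarrow> lamp set \<Rightarrow> real \<Rightarrow> real" where
  "LL_IDS m S E = measure (LL_spec_measure m S) {..E}"

end

theory Submission
  imports Defs "HOL-Probability.Probability" "HOL-Real_Asymp.Real_Asymp" "HOL-Algebra.Group"
begin

text \<open>Let \<open>\<mu>\<close> be the spectral measure of \<open>\<Delta>\<close> at \<open>\<delta>\<close>, and let \<open>u = q(\<Delta>)\<delta>\<close> for a polynomial \<open>q\<close>.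

  Upper bound: let \<open>A\<close> be a set of \<open>2 ^ n\<close> group elements of word length at most \<open>Cn\<close>. Replacing \<open>u\<close> by
  the average \<open>v\<close> of its right translates by \<open>A\<close> changes it by at most \<open>Cn (2\<langle>\<Delta>u, u\<rangle>)^(1/2)\<close>, while
  traciality gives \<open>\<parallel>v\<parallel> = \<parallel>q(\<Delta>) 1_A\<parallel> / |A|\<close>. Approximating a cut-off function at energy \<open>E\<close> by \<open>q\<close> yields
  \<open>N\<^sub>0(E) \<le> 4 / 2 ^ n\<close> as soon as \<open>16 C\<^sup>2 n\<^sup>2 E \<le> 1\<close>.

  Lower bound: a test function \<open>h\<close> supported on \<open>\<Omega>\<close> with Rayleigh quotient at most \<open>E / 4\<close> has at least half
  of its spectral mass in \<open>[0, E]\<close>; by Cauchy-Schwarz and left invariance its spectral measure is bounded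
  by \<open>|\<Omega>| \<parallel>h\<parallel>\<^sup>2 \<mu>\<close>, so \<open>N\<^sub>0(E) \<ge> 1 / (2 |\<Omega>|)\<close>. A tent function in the position of the lamplighter,
  with lamps confined to a box of size of order \<open>E^(-1/2)\<close>, has the required Rayleigh quotient; this gives
  the lower bound even for \<open>r = 1/2\<close>.\<close>

section \<open>Spectral measures of bounded positive operators\<close>

text \<open>Only form bounds on a possibly incomplete inner product space are required, so that the
  Laplacian on finitely supported functions qualifies. Spectral measures are built from the moments
  of \<open>T\<close> rather than from projections.\<close>

locale positive_operator =
  fixes T :: "'a::real_inner \<Rightarrow> 'a" and c :: real
  assumes linear: "linear T"
    and sym: "T x \<bullet> y = x \<bullet> T y"
    and nonneg: "0 \<le> T x \<bullet> x"
    and bounded: "T x \<bullet> x \<le> c * (x \<bullet> x)"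
    and c_pos: "0 < c"
begin

section \<open>Polynomial functional calculus and its positivity\<close>

definition fcalc :: "real poly \<Rightarrow> 'a \<Rightarrow> 'a" where
  "fcalc p x = (\<Sum>i\<le>degree p. coeff p i *\<^sub>R (T ^^ i) x)"

lemma fcalc_eq_sum:
  assumes "degree p \<le> n"
  shows "fcalc p x = (\<Sum>i\<le>n. coeff p i *\<^sub>R (T ^^ i) x)"
  unfolding fcalc_def using assms
  by (intro sum.mono_neutral_left) (auto simp: coeff_eq_0)

lemma linear_fcalc: "linear (fcalc p)"
proof -
  have "linear (T ^^ i)" for i
    by (induction i) (use linear in \<open>auto simp: linear_iff\<close>)
  then show ?thesis
    unfolding fcalc_def by (intro linear_compose_sum) (auto intro: linear_compose_scale_right)
qed

lemma fcalc_add: "fcalc (p + q) x = fcalc p x + fcalc q x"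
proof -
  let ?n = "max (degree p) (degree q)"
  have "degree (p + q) \<le> ?n" by (rule degree_add_le_max)
  then show ?thesis
    by (simp add: fcalc_eq_sum[of _ ?n] sum.distrib scaleR_add_left)
qed

lemma fcalc_smult: "fcalc (smult a p) x = a *\<^sub>R fcalc p x"
  by (simp add: fcalc_eq_sum[of "smult a p" "degree p"] fcalc_def scaleR_sum_right)

lemma fcalc_0 [simp]: "fcalc 0 x = 0"
  by (simp add: fcalc_def)

lemma fcalc_sum: "fcalc (\<Sum>i\<in>I. p i) x = (\<Sum>i\<in>I. fcalc (p i) x)"
  by (induction I rule: infinite_finite_induct) (auto simp: fcalc_add)

lemma fcalc_pCons: "fcalc (pCons a p) x = a *\<^sub>R x + T (fcalc p x)"
proof -
  have "fcalc (pCons a p) x = (\<Sum>i\<le>Suc (degree p). coeff (pCons a p) i *\<^sub>R (T ^^ i) x)"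
    by (rule fcalc_eq_sum) (simp add: degree_pCons_le)
  also have "\<dots> = a *\<^sub>R x + (\<Sum>i\<le>degree p. coeff p i *\<^sub>R T ((T ^^ i) x))"
    by (subst sum.atMost_Suc_shift) simp
  also have "\<dots> = a *\<^sub>R x + T (fcalc p x)"
    by (simp add: fcalc_def linear_sum[OF linear] linear_scale[OF linear])
  finally show ?thesis .
qed

lemma fcalc_mult: "fcalc (p * q) x = fcalc p (fcalc q x)"
proof (induction p)
  case (pCons a p)
  have "fcalc (pCons a p * q) x = a *\<^sub>R fcalc q x + fcalc (pCons 0 (p * q)) x"
    by (simp add: mult_pCons_left fcalc_add fcalc_smult)
  then show ?case using pCons by (simp add: fcalc_pCons)
qed auto

lemma fcalc_1 [simp]: "fcalc 1 x = x"
  by (simp add: fcalc_def)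

lemma fcalc_X: "fcalc [:0, 1:] x = T x"
  by (simp add: fcalc_pCons linear_0[OF linear])

lemma fcalc_commute:
  assumes "linear U" "\<And>x. U (T x) = T (U x)"
  shows "U (fcalc p x) = fcalc p (U x)"
  using assms
  by (induction p) (auto simp: fcalc_pCons linear_0 linear_add linear_scale)

lemma fcalc_sym: "fcalc p x \<bullet> y = x \<bullet> fcalc p y"
proof (induction p arbitrary: y)
  case (pCons a p)
  have "T (fcalc p x) \<bullet> y = fcalc p x \<bullet> T y" by (rule sym)
  also have "\<dots> = x \<bullet> fcalc p (T y)" by (rule pCons.IH)
  also have "fcalc p (T y) = T (fcalc p y)" by (rule fcalc_commute[OF linear, symmetric]) simp
  finally show ?case by (simp add: fcalc_pCons inner_add)
qed auto

lemma fcalc_power_X: "fcalc ([:0, 1:] ^ n) x = (T ^^ n) x"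
  by (induction n) (auto simp: fcalc_mult fcalc_X simp del: mult_pCons_left)

lemma norm_fcalc: "(norm (fcalc p x))\<^sup>2 = fcalc (p\<^sup>2) x \<bullet> x"
  by (simp only: power2_norm_eq_inner power2_eq_square[of p] fcalc_mult fcalc_sym[of p "fcalc p x"])

text \<open>Symmetry moves one factor \<open>p\<close> to the other side of the inner product, which
  leaves the form of \<open>T\<close> at \<open>fcalc p x\<close>. The next lemma does the same with
  \<open>c - T\<close>.\<close>

lemma fcalc_X_square_nonneg: "0 \<le> fcalc ([:0, 1:] * p\<^sup>2) x \<bullet> x"
proof -
  have "fcalc ([:0, 1:] * p\<^sup>2) x \<bullet> x = fcalc (p * ([:0, 1:] * p)) x \<bullet> x"
    by (simp only: power2_eq_square mult.left_commute)
  also have "\<dots> = T (fcalc p x) \<bullet> fcalc p x"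
    by (simp only: fcalc_mult fcalc_X fcalc_sym[of p "T _"])
  finally show ?thesis by (simp add: nonneg)
qed

lemma fcalc_co_X_square_nonneg: "0 \<le> fcalc ([:c, -1:] * p\<^sup>2) x \<bullet> x"
proof -
  have *: "fcalc [:c, -1:] y = c *\<^sub>R y - T y" for y
    by (simp add: fcalc_pCons linear_0[OF linear] linear_neg[OF linear])
  have "fcalc ([:c, -1:] * p\<^sup>2) x \<bullet> x = fcalc (p * ([:c, -1:] * p)) x \<bullet> x"
    by (simp only: power2_eq_square mult.left_commute)
  also have "\<dots> = fcalc [:c, -1:] (fcalc p x) \<bullet> fcalc p x"
    by (simp only: fcalc_mult fcalc_sym[of p "fcalc _ _"])
  also have "\<dots> = c * (fcalc p x \<bullet> fcalc p x) - T (fcalc p x) \<bullet> fcalc p x"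
    by (simp add: * inner_diff)
  finally show ?thesis using bounded[of "fcalc p x"] by simp
qed

text \<open>Splitting off even powers leaves a square times 1, \<open>X\<close>, \<open>Y\<close> or
  \<open>X * Y\<close>, where \<open>X + Y = c\<close>. The first three are settled by symmetry and
  the form bounds; the last reduces to them by \<open>c X Y = Y X^2 + X Y^2\<close>. These are the
  weights of the Bernstein distributions below.\<close>

lemma fcalc_bernstein_nonneg: "0 \<le> fcalc ([:0, 1:] ^ i * [:c, -1:] ^ j) x \<bullet> x"
proof -
  define X Y where "X = [:0, 1::real:]" and "Y = [:c, -1:]"
  have sq: "0 \<le> fcalc (p\<^sup>2) x \<bullet> x" for p by (simp flip: norm_fcalc)
  have X: "0 \<le> fcalc (X * p\<^sup>2) x \<bullet> x" and Y: "0 \<le> fcalc (Y * p\<^sup>2) x \<bullet> x" for p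
    unfolding X_def Y_def by (rule fcalc_X_square_nonneg fcalc_co_X_square_nonneg)+
  have XY: "smult c (X * Y * p\<^sup>2) = Y * (X * p)\<^sup>2 + X * (Y * p)\<^sup>2" for p
  proof -
    have c: "[:c:] = X + Y" by (simp add: X_def Y_def)
    have "smult c (X * Y * p\<^sup>2) = [:c:] * (X * Y * p\<^sup>2)" by simp
    then show ?thesis unfolding c by (simp add: algebra_simps power2_eq_square)
  qed
  have XY': "0 \<le> fcalc (X * Y * p\<^sup>2) x \<bullet> x" for p
  proof -
    have "c * (fcalc (X * Y * p\<^sup>2) x \<bullet> x) = fcalc (smult c (X * Y * p\<^sup>2)) x \<bullet> x"
      by (simp add: fcalc_smult)
    also have "\<dots> \<ge> 0" unfolding XY by (simp add: fcalc_add inner_add X Y)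
    finally show ?thesis using c_pos by (simp add: zero_le_mult_iff)
  qed
  have "X ^ (2 * a) * Y ^ (2 * b) = (X ^ a * Y ^ b)\<^sup>2"
    "X ^ (2 * a + 1) * Y ^ (2 * b) = X * (X ^ a * Y ^ b)\<^sup>2"
    "X ^ (2 * a) * Y ^ (2 * b + 1) = Y * (X ^ a * Y ^ b)\<^sup>2"
    "X ^ (2 * a + 1) * Y ^ (2 * b + 1) = X * Y * (X ^ a * Y ^ b)\<^sup>2" for a b
    by (simp_all add: power_mult_distrib power_mult[symmetric] mult_ac power_add)
  note cases = this
  have "0 \<le> fcalc (X ^ i * Y ^ j) x \<bullet> x"
    by (cases "even i"; cases "even j"; elim evenE oddE; hypsubst; simp only: cases sq X Y XY')
  then show ?thesis
    unfolding X_def Y_def .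
qed

end

section \<open>Factorial moments and their distance from ordinary powers\<close>

lemma sum_binomial_mult_choose:
  fixes x y :: "'a::comm_semiring_1"
  assumes "k \<le> n"
  shows "(\<Sum>i\<le>n. of_nat (n choose i) * of_nat (i choose k) * (x ^ i * y ^ (n - i)))
         = of_nat (n choose k) * x ^ k * (x + y) ^ (n - k)"
proof -
  let ?f = "\<lambda>i. of_nat (n choose i) * of_nat (i choose k) * (x ^ i * y ^ (n - i))"
  have "(\<Sum>i\<le>n. ?f i) = (\<Sum>i\<in>{k..n}. ?f i)"
    by (intro sum.mono_neutral_right) (auto simp: binomial_eq_0)
  also have "\<dots> = (\<Sum>j\<le>n - k. ?f (j + k))"
    using assms by (intro sum.reindex_bij_witness[of _ "\<lambda>j. j + k" "\<lambda>i. i - k"]) auto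
  also have "\<dots> = (\<Sum>j\<le>n - k. of_nat (n choose k) * x ^ k *
                     (of_nat ((n - k) choose j) * x ^ j * y ^ (n - k - j)))"
  proof (intro sum.cong refl)
    fix j assume "j \<in> {..n - k}"
    \<comment> \<open>Choosing \<open>j + k\<close> elements and then \<open>k\<close> of them
      amounts to choosing the \<open>k\<close> first, so a constant factors out and the binomial
      theorem applies to the rest.\<close>
    then have "(n choose (j + k)) * ((j + k) choose k) = (n choose k) * ((n - k) choose j)"
      using choose_mult[of k "j + k" n] assms by auto
    then have "of_nat (n choose (j + k)) * of_nat ((j + k) choose k)
        = (of_nat (n choose k) * of_nat ((n - k) choose j) :: 'a)"
      by (metis of_nat_mult)
    moreover have "n - (j + k) = n - k - j" by simp
    ultimately show "?f (j + k) = of_nat (n choose k) * x ^ k *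
                     (of_nat ((n - k) choose j) * x ^ j * y ^ (n - k - j))"
      by (simp add: power_add mult_ac)
  qed
  also have "\<dots> = of_nat (n choose k) * x ^ k * (x + y) ^ (n - k)"
    by (simp add: binomial_ring flip: sum_distrib_left)
  finally show ?thesis .
qed

text \<open>Both binomial coefficients are falling factorials over \<open>k!\<close>. As a function
  of \<open>i / n\<close>, the product is a perturbation of the \<open>k\<close>-th power.\<close>

lemma prod_ratio_eq_choose_ratio:
  assumes "k \<le> n"
  shows "(\<Prod>j<k. (real i - real j) / (real n - real j)) = real (i choose k) / real (n choose k)"
proof -
  have *: "real (m choose k) * fact k = (\<Prod>j<k. real m - real j)" for m
    by (simp only: binomial_gbinomial gbinomial_prod_rev atLeast0LessThan of_nat_gbinomial) simp
  have "(\<Prod>j<k. (real i - real j) / (real n - real j))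
      = (real (i choose k) * fact k) / (real (n choose k) * fact k)"
    unfolding * by (rule prod_dividef)
  then show ?thesis by simp
qed



text \<open>Products of factors of absolute value at most 1 differ by at most the sum of the
  differences of the factors, and factor \<open>j\<close> differs from \<open>t\<close> by
  \<open>j (1 - t) / (n - j)\<close>. The condition \<open>2 * k < n\<close> bounds the factors by 1
  even for \<open>t\<close> near 0, where they are negative.\<close>

lemma prod_ratio_close_to_power:
  fixes t :: real
  assumes "0 \<le> t" "t \<le> 1" "2 * k < n"
  shows "\<bar>(\<Prod>j<k. (real n * t - real j) / (real n - real j)) - t ^ k\<bar> \<le> real k * (real k / (real n - real k))"
proof -
  have "norm ((real n * t - real j) / (real n - real j)) \<le> 1" if "j < k" for j
  proof -
    have "real n * t \<le> real n" "0 \<le> real n * t"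
      using assms by (auto intro: mult_left_le)
    moreover have "2 * real j \<le> real n" "real j < real n"
      using assms that by linarith+
    ultimately have "\<bar>real n * t - real j\<bar> \<le> real n - real j" "0 < real n - real j" by linarith+
    then show ?thesis by simp
  qed
  then have "norm ((\<Prod>j<k. (real n * t - real j) / (real n - real j)) - (\<Prod>j<k. t))
      \<le> (\<Sum>j<k. norm ((real n * t - real j) / (real n - real j) - t))"
    using assms by (intro norm_prod_diff) auto
  also have "\<dots> \<le> (\<Sum>j<k. real k / (real n - real k))"
  proof (intro sum_mono)
    fix j assume "j \<in> {..<k}"
    then have j: "real j \<le> real k" "real j < real n" "real k < real n" using assms by auto
    then have "(real n * t - real j) / (real n - real j) - t = - (real j * (1 - t) / (real n - real j))"
      by (simp add: field_simps)
    then have "norm ((real n * t - real j) / (real n - real j) - t) = real j * (1 - t) / (real n - real j)"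
      using assms j by simp
    also have "\<dots> \<le> real k / (real n - real k)"
      using assms j by (intro frac_le) (auto intro: order_trans[OF mult_left_le])
    finally show "norm ((real n * t - real j) / (real n - real j) - t) \<le> real k / (real n - real k)" .
  qed
  finally show ?thesis by simp
qed

section \<open>The Hausdorff moment problem for the moments of \<open>T\<close>\<close>

context positive_operator
begin

text \<open>The binomial sum is applied to the polynomials \<open>X\<close> and
  \<open>c - X\<close>, whose sum is constant; of the power of the sum only a power of
  \<open>c\<close> remains.\<close>

lemma bernstein_moment:
  assumes "k \<le> n"
  shows "(\<Sum>i\<le>n. real (n choose i) * real (i choose k) *
            (fcalc ([:0, 1:] ^ i * [:c, -1:] ^ (n - i)) x \<bullet> x) / c ^ n)
         = real (n choose k) * ((T ^^ k) x \<bullet> x) / c ^ k"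
proof -
  let ?X = "[:0, 1::real:]" and ?Y = "[:c, -1:]"
  have "(\<Sum>i\<le>n. real (n choose i) * real (i choose k) * (fcalc (?X ^ i * ?Y ^ (n - i)) x \<bullet> x))
      = fcalc (\<Sum>i\<le>n. of_nat (n choose i) * of_nat (i choose k) * (?X ^ i * ?Y ^ (n - i))) x \<bullet> x"
    by (simp add: fcalc_sum inner_sum_left of_nat_poly fcalc_smult mult_ac)
  also have "(\<Sum>i\<le>n. of_nat (n choose i) * of_nat (i choose k) * (?X ^ i * ?Y ^ (n - i)))
      = of_nat (n choose k) * ?X ^ k * (?X + ?Y) ^ (n - k)"
    by (rule sum_binomial_mult_choose[OF assms])
  also have "\<dots> = smult (real (n choose k) * c ^ (n - k)) (?X ^ k)"
    by (simp add: of_nat_poly poly_const_pow mult.commute)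
  also have "fcalc \<dots> x \<bullet> x = real (n choose k) * c ^ (n - k) * ((T ^^ k) x \<bullet> x)"
    by (simp only: fcalc_smult fcalc_power_X inner_scaleR_left)
  finally have "(\<Sum>i\<le>n. real (n choose i) * real (i choose k) * (fcalc (?X ^ i * ?Y ^ (n - i)) x \<bullet> x))
      = real (n choose k) * c ^ (n - k) * ((T ^^ k) x \<bullet> x)" .
  moreover have "c ^ n = c ^ (n - k) * c ^ k"
    using assms by (simp flip: power_add)
  ultimately show ?thesis
    using c_pos by (simp flip: sum_divide_distrib)
qed

text \<open>The mass at \<open>c * i / n\<close> is the quadratic form of the \<open>i\<close>-th
  Bernstein polynomial of \<open>T\<close> at \<open>x\<close>. Its rescaled factorial moments of
  order at most \<open>n\<close> are exactly those of \<open>T\<close>; only the passage to ordinary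
  powers needs a limit.\<close>

lemma bernstein_distribution:
  assumes "norm x = 1"
  obtains \<mu> :: "real measure"
  where "real_distribution \<mu>" "AE z in \<mu>. z \<in> {0..c}"
    "\<And>k. k \<le> n \<Longrightarrow> (\<integral>z. (\<Prod>j<k. (real n * (z / c) - real j) / (real n - real j)) \<partial>\<mu>)
                    = (T ^^ k) x \<bullet> x / c ^ k"
proof -
  define w where "w i = real (n choose i) *
      (fcalc ([:0, 1:] ^ i * [:c, -1:] ^ (n - i)) x \<bullet> x) / c ^ n" for i
  have w_nonneg: "0 \<le> w i" for i
    unfolding w_def using c_pos by (intro divide_nonneg_pos mult_nonneg_nonneg fcalc_bernstein_nonneg) auto
  have w_0: "w i = 0" if "i > n" for i using that by (simp add: w_def)
  have w_moment: "(\<Sum>i\<le>n. real (i choose k) * w i) = real (n choose k) * ((T ^^ k) x \<bullet> x / c ^ k)"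
    if "k \<le> n" for k
    using bernstein_moment[OF that, of x] by (simp add: w_def mult_ac)
  have "x \<bullet> x = 1" using assms by (simp add: norm_eq_sqrt_inner)
  \<comment> \<open>The moment of order 0 is the squared norm of \<open>x\<close>, so the weights
    form a probability.\<close>
  then have w_sum: "(\<Sum>i\<le>n. w i) = 1" using w_moment[of 0] by simp
  have w_prob: "(\<integral>\<^sup>+i. ennreal (w i) \<partial>count_space UNIV) = 1"
  proof -
    have "(\<integral>\<^sup>+i. ennreal (w i) \<partial>count_space UNIV) = (\<Sum>i\<le>n. ennreal (w i))"
      by (intro nn_integral_count_space') (auto simp: w_0 not_le)
    also have "\<dots> = 1" using w_nonneg by (simp add: w_sum sum_ennreal)
    finally show ?thesis .
  qed
  define p where "p = embed_pmf w"
  have pmf: "pmf p i = w i" for i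
    unfolding p_def by (rule pmf_embed_pmf[OF w_nonneg w_prob])
  then have supp: "i \<le> n" if "i \<in> set_pmf p" for i
    using that w_0[of i] by (force simp: set_pmf_eq)
  define \<mu> where "\<mu> = distr (measure_pmf p) borel (\<lambda>i. c * (real i / real n))"
  show ?thesis
  proof
    show "real_distribution \<mu>"
      unfolding \<mu>_def by (intro prob_space.real_distribution_distr[OF prob_space_measure_pmf]) simp
    show "AE z in \<mu>. z \<in> {0..c}"
      unfolding \<mu>_def
    proof (subst AE_distr_iff)
      show "AE i in measure_pmf p. c * (real i / real n) \<in> {0..c}"
        using c_pos supp
        by (force simp: AE_measure_pmf_iff divide_le_eq)
    qed auto
    fix k assume k: "k \<le> n"
    show "(\<integral>z. (\<Prod>j<k. (real n * (z / c) - real j) / (real n - real j)) \<partial>\<mu>)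
                    = (T ^^ k) x \<bullet> x / c ^ k"
    proof -
      have "(\<integral>z. (\<Prod>j<k. (real n * (z / c) - real j) / (real n - real j)) \<partial>\<mu>)
          = (\<integral>i. (\<Prod>j<k. (real n * (real i / real n) - real j) / (real n - real j)) \<partial>measure_pmf p)"
        unfolding \<mu>_def using c_pos by (subst integral_distr) auto
      also have "\<dots> = (\<Sum>i\<le>n. (\<Prod>j<k. (real n * (real i / real n) - real j) / (real n - real j)) * pmf p i)"
        by (intro integral_measure_pmf_real) (auto simp: supp)
      also have "\<dots> = (\<Sum>i\<le>n. real (i choose k) / real (n choose k) * w i)"
      proof (intro sum.cong refl)
        fix i assume i: "i \<in> {..n}"
        \<comment> \<open>For \<open>n = 0\<close> the only index is \<open>i = 0\<close>, and
          division by zero gives 0, so the cancellation still holds.\<close>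
        then have "real n * (real i / real n) = real i" by auto
        then show "(\<Prod>j<k. (real n * (real i / real n) - real j) / (real n - real j)) * pmf p i
            = real (i choose k) / real (n choose k) * w i"
          by (simp only: prod_ratio_eq_choose_ratio[OF k] pmf)
      qed
      also have "\<dots> = (\<Sum>i\<le>n. real (i choose k) * w i) / real (n choose k)"
        by (simp add: sum_divide_distrib)
      also have "\<dots> = (T ^^ k) x \<bullet> x / c ^ k"
        using k by (simp add: w_moment)
      finally show ?thesis .
    qed
  qed
qed

text \<open>The solution of the Hausdorff moment problem: the discrete Bernstein distributions have a
  weakly convergent subsequence, whose limit has the right moments.\<close>

lemma spectral_distribution_unit:
  assumes "norm x = 1"
  obtains M :: "real measure"
  where "real_distribution M" "AE z in M. z \<in> {0..c}"
    "\<And>k. (\<integral>z. z ^ k \<partial>M) = (T ^^ k) x \<bullet> x"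
proof -
  have "\<exists>\<mu>. real_distribution \<mu> \<and> (AE z in \<mu>. z \<in> {0..c}) \<and>
    (\<forall>k\<le>n. (\<integral>z. (\<Prod>j<k. (real n * (z / c) - real j) / (real n - real j)) \<partial>\<mu>)
                    = (T ^^ k) x \<bullet> x / c ^ k)" for n
    by (rule bernstein_distribution[OF assms, of n]) blast
  then obtain \<mu> where "\<forall>n. real_distribution (\<mu> n) \<and> (AE z in \<mu> n. z \<in> {0..c}) \<and>
    (\<forall>k\<le>n. (\<integral>z. (\<Prod>j<k. (real n * (z / c) - real j) / (real n - real j)) \<partial>\<mu> n)
                    = (T ^^ k) x \<bullet> x / c ^ k)"
    using choice[of "\<lambda>n \<mu>. real_distribution \<mu> \<and> (AE z in \<mu>. z \<in> {0..c}) \<and>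
    (\<forall>k\<le>n. (\<integral>z. (\<Prod>j<k. (real n * (z / c) - real j) / (real n - real j)) \<partial>\<mu>)
                    = (T ^^ k) x \<bullet> x / c ^ k)"] by blast
  then have \<mu>: "\<And>n. real_distribution (\<mu> n)" and \<mu>_AE: "\<And>n. AE z in \<mu> n. z \<in> {0..c}"
    and \<mu>_int: "\<And>n k. k \<le> n \<Longrightarrow> (\<integral>z. (\<Prod>j<k. (real n * (z / c) - real j) / (real n - real j)) \<partial>\<mu> n)
                    = (T ^^ k) x \<bullet> x / c ^ k"
    by blast+
  interpret \<mu>: real_distribution "\<mu> n" for n by (rule \<mu>)
  \<comment> \<open>All mass lies in \<open>[0, c]\<close>; starting the half-open interval at -1
    keeps the point 0 inside.\<close>
  have "tight \<mu>"
    unfolding tight_def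
  proof (intro conjI allI impI \<mu>)
    fix \<epsilon> :: real assume "\<epsilon> > 0"
    have "measure (\<mu> n) {-1<..c} = 1" for n
      using \<mu>_AE[of n] by (subst \<mu>.prob_eq_1) (auto elim: eventually_mono)
    with \<open>\<epsilon> > 0\<close> show "\<exists>a b. a < b \<and> (\<forall>n. 1 - \<epsilon> < measure (\<mu> n) {a<..b})"
      using c_pos by (intro exI[of _ "-1"] exI[of _ c]) auto
  qed
  from tight_imp_convergent_subsubsequence[OF this strict_mono_id]
  obtain r M where r: "strict_mono (r :: nat \<Rightarrow> nat)" and M: "real_distribution M"
    and conv: "weak_conv_m (\<mu> \<circ> r) M"
    by auto
  interpret M: real_distribution M by (rule M)
  \<comment> \<open>Weak convergence tests only bounded continuous functions on the whole line.
    Clamping makes the powers bounded and leaves them unchanged on \<open>[0, c]\<close>.\<close>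
  define clamp where "clamp z = max 0 (min c z)" for z
  have clamp: "clamp z \<in> {0..c}" "z \<in> {0..c} \<Longrightarrow> clamp z = z" for z
    using c_pos by (auto simp: clamp_def)
  have clamp_cont: "isCont clamp z" for z unfolding clamp_def by (intro continuous_intros)
  have [measurable]: "clamp \<in> borel_measurable borel" unfolding clamp_def by measurable
  have lim: "(\<lambda>n. \<integral>z. f z \<partial>\<mu> (r n)) \<longlonglongrightarrow> (\<integral>z. f z \<partial>M)"
    if "\<And>z. isCont f z" "\<And>z. norm (f z) \<le> 1" for f :: "real \<Rightarrow> real"
    using weak_conv_imp_integral_bdd_continuous_conv[OF _ M conv that] \<mu> by simp
  have M_AE: "AE z in M. z \<in> {0..c}"
  proof -
    \<comment> \<open>A bounded continuous function vanishing exactly on \<open>[0, c]\<close>: its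
      integrals are 0 along the sequence, hence also in the limit.\<close>
    let ?d = "\<lambda>z. min 1 \<bar>z - clamp z\<bar>"
    have "(\<lambda>n. \<integral>z. ?d z \<partial>\<mu> (r n)) \<longlonglongrightarrow> (\<integral>z. ?d z \<partial>M)"
      by (rule lim) (auto intro!: continuous_intros clamp_cont)
    moreover have "(\<integral>z. ?d z \<partial>\<mu> n) = 0" for n
    proof -
      have "(\<integral>z. ?d z \<partial>\<mu> n) = (\<integral>z. 0 \<partial>\<mu> n)"
      proof (rule integral_cong_AE)
        show "AE z in \<mu> n. ?d z = 0"
          using \<mu>_AE[of n] by eventually_elim (simp add: clamp)
      qed auto
      then show ?thesis by simp
    qed
    ultimately have "(\<integral>z. ?d z \<partial>M) = 0" by (simp add: LIMSEQ_const_iff)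
    moreover have "integrable M ?d" by (rule M.integrable_const_bound[of _ 1]) auto
    ultimately have "AE z in M. ?d z = 0"
      by (subst (asm) integral_nonneg_eq_0_iff_AE) auto
    then show ?thesis
    proof eventually_elim
      case (elim z)
      then have "z = clamp z" by (auto simp: min_def split: if_splits)
      then show ?case using clamp(1)[of z] by simp
    qed
  qed
  show ?thesis
  proof (rule that[OF M M_AE])
    fix k
    let ?m = "(T ^^ k) x \<bullet> x / c ^ k"
    let ?f = "\<lambda>z. (clamp z / c) ^ k"
    have unit: "0 \<le> clamp z / c" "clamp z / c \<le> 1" for z using clamp(1)[of z] c_pos by auto
    have f_bound: "norm (?f z) \<le> 1" for z
      using unit[of z] by (auto simp: power_le_one)
    have "(\<lambda>n. \<integral>z. ?f z \<partial>\<mu> (r n)) \<longlonglongrightarrow> (\<integral>z. ?f z \<partial>M)"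
      using c_pos by (intro lim f_bound continuous_intros clamp_cont) auto
    moreover have "(\<lambda>n. \<integral>z. ?f z \<partial>\<mu> (r n)) \<longlonglongrightarrow> ?m"
    proof -
      have "\<bar>(\<integral>z. ?f z \<partial>\<mu> n) - ?m\<bar> \<le> real k * (real k / (real n - real k))" if n: "2 * k < n" for n
      proof -
        \<comment> \<open>The integral of \<open>g\<close> is the exact moment, and \<open>g\<close>
          is uniformly within O(1/n) of the clamped power.\<close>
        define g where "g z = (\<Prod>j<k. (real n * (clamp z / c) - real j) / (real n - real j))" for z
        have [measurable]: "g \<in> borel_measurable borel" unfolding g_def by measurable
        have diff: "\<bar>g z - ?f z\<bar> \<le> real k * (real k / (real n - real k))" for z
          unfolding g_def using unit n by (intro prod_ratio_close_to_power)
        have intf: "integrable (\<mu> n) ?f"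
          by (rule \<mu>.integrable_const_bound[of _ 1]) (use f_bound in auto)
        have intgf: "integrable (\<mu> n) (\<lambda>z. g z - ?f z)"
          by (rule \<mu>.integrable_const_bound[of _ "real k * (real k / (real n - real k))"])
             (use diff in auto)
        have intg: "integrable (\<mu> n) g"
          using Bochner_Integration.integrable_add[OF intgf intf] by simp
        have "?m = (\<integral>z. g z \<partial>\<mu> n)"
        proof -
          have "(\<integral>z. g z \<partial>\<mu> n) = (\<integral>z. (\<Prod>j<k. (real n * (z / c) - real j) / (real n - real j)) \<partial>\<mu> n)"
          proof (rule integral_cong_AE)
            show "AE z in \<mu> n. g z = (\<Prod>j<k. (real n * (z / c) - real j) / (real n - real j))"
              using \<mu>_AE[of n] by eventually_elim (simp add: clamp g_def)
          qed auto
          then show ?thesis using \<mu>_int[of k n] n by simp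
        qed
        then have "\<bar>(\<integral>z. ?f z \<partial>\<mu> n) - ?m\<bar> = \<bar>\<integral>z. g z - ?f z \<partial>\<mu> n\<bar>"
          using intf intg by (simp add: abs_minus_commute)
        also have "\<dots> \<le> (\<integral>z. \<bar>g z - ?f z\<bar> \<partial>\<mu> n)" by (rule integral_abs_bound)
        also have "\<dots> \<le> (\<integral>z. real k * (real k / (real n - real k)) \<partial>\<mu> n)"
          by (intro integral_mono diff integrable_abs intgf) auto
        finally show ?thesis by (simp add: \<mu>.prob_space[unfolded \<mu>.space_eq_univ])
      qed
      then have "\<forall>\<^sub>F n in sequentially. norm ((\<integral>z. ?f z \<partial>\<mu> n) - ?m) \<le> real k * (real k / (real n - real k))"
        by (intro eventually_mono[OF eventually_gt_at_top[of "2 * k"]]) simp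
      moreover have "(\<lambda>n. real k * (real k / (real n - real k))) \<longlonglongrightarrow> 0"
        by real_asymp
      ultimately have "(\<lambda>n. (\<integral>z. ?f z \<partial>\<mu> n) - ?m) \<longlonglongrightarrow> 0"
        by (rule Lim_null_comparison)
      then show ?thesis
        using LIMSEQ_subseq_LIMSEQ[OF _ r] by (auto simp: LIM_zero_iff o_def)
    qed
    ultimately have "(\<integral>z. ?f z \<partial>M) = ?m" by (rule LIMSEQ_unique)
    moreover have "(\<integral>z. ?f z \<partial>M) = (\<integral>z. z ^ k / c ^ k \<partial>M)"
    proof (rule integral_cong_AE)
      show "AE z in M. ?f z = z ^ k / c ^ k"
        using M_AE by eventually_elim (simp add: clamp power_divide)
    qed auto
    ultimately show "(\<integral>z. z ^ k \<partial>M) = (T ^^ k) x \<bullet> x"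
      using c_pos by simp
  qed
qed

end

section \<open>Distributions on a compact interval: approximation and determinacy\<close>

locale interval_distribution = real_distribution M for M +
  fixes c :: real
  assumes AE_interval: "AE z in M. z \<in> {0..c}"
begin

lemma integrable_continuous:
  fixes f :: "real \<Rightarrow> real"
  assumes "continuous_on UNIV f"
  shows "integrable M f"
proof -
  have "bounded (f ` {0..c})"
    using assms by (intro compact_imp_bounded compact_continuous_image) (auto intro: continuous_on_subset)
  then obtain B where "\<forall>y\<in>f ` {0..c}. norm y \<le> B"
    unfolding bounded_iff ..
  then have "AE z in M. norm (f z) \<le> B"
    by (intro eventually_mono[OF AE_interval]) blast
  then show ?thesis
    using borel_measurable_continuous_onI[OF assms]
    by (intro integrable_const_bound[of _ B]) auto
qed

lemma integral_poly: "(\<integral>z. poly p z \<partial>M) = (\<Sum>i\<le>degree p. coeff p i * (\<integral>z. z ^ i \<partial>M))"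
proof -
  have "integrable M (\<lambda>z. z ^ i)" for i
    by (intro integrable_continuous continuous_intros)
  then show ?thesis by (simp add: poly_altdef)
qed

end

lemma Weierstrass_poly:
  fixes f :: "real \<Rightarrow> real"
  assumes "continuous_on {a..b} f" "0 < e"
  obtains q where "\<And>z. z \<in> {a..b} \<Longrightarrow> \<bar>poly q z - f z\<bar> < e"
proof -
  obtain g where g: "real_polynomial_function g" "\<And>z. z \<in> {a..b} \<Longrightarrow> \<bar>f z - g z\<bar> < e"
    using Stone_Weierstrass_real_polynomial_function[OF compact_Icc assms] by metis
  from g(1) obtain a' n where "g = (\<lambda>z. \<Sum>i\<le>n. a' i * z ^ i)"
    unfolding real_polynomial_function_iff_sum by blast
  then have "poly (\<Sum>i\<le>n. monom (a' i) i) = g"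
    by (simp add: fun_eq_iff poly_sum poly_monom)
  then show ?thesis using that[of "\<Sum>i\<le>n. monom (a' i) i"] g(2) by (simp add: abs_minus_commute)
qed

text \<open>A polynomial close to \<open>sqrt g\<close> on \<open>[0, c]\<close> has a square close
  to \<open>g\<close>, so an inequality for squares of polynomials passes to \<open>g\<close> by
  dominated convergence. This carries norm inequalities for \<open>q(T)\<close> over to continuous
  cut-offs.\<close>

lemma integral_le_of_poly_square:
  fixes g G1 G2 :: "real \<Rightarrow> real"
  assumes M1: "interval_distribution M1 c" and M2: "interval_distribution M2 c"
    and cont: "continuous_on UNIV g" "continuous_on UNIV G1" "continuous_on UNIV G2"
    and g_nonneg: "\<And>z. 0 \<le> g z"
    and le: "\<And>q. (\<integral>z. (poly q z)\<^sup>2 * G1 z \<partial>M1) \<le> (\<integral>z. (poly q z)\<^sup>2 * G2 z \<partial>M2)"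
  shows "(\<integral>z. g z * G1 z \<partial>M1) \<le> (\<integral>z. g z * G2 z \<partial>M2)"
proof -
  have "\<exists>q. \<forall>z\<in>{0..c}. \<bar>poly q z - sqrt (g z)\<bar> < 1 / real (Suc n)" for n
  proof -
    have "continuous_on {0..c} (\<lambda>z. sqrt (g z))"
      by (intro continuous_intros continuous_on_subset[OF cont(1)]) auto
    then show ?thesis
      by (rule Weierstrass_poly[of 0 c _ "1 / real (Suc n)"]) (simp, blast)
  qed
  then have "\<forall>n. \<exists>q. \<forall>z\<in>{0..c}. \<bar>poly q z - sqrt (g z)\<bar> < 1 / real (Suc n)" ..
  from choice[OF this] obtain q
    where q: "\<And>n z. z \<in> {0..c} \<Longrightarrow> \<bar>poly (q n) z - sqrt (g z)\<bar> < 1 / real (Suc n)"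
    by blast
  have "(\<lambda>n. \<integral>z. (poly (q n) z)\<^sup>2 * G z \<partial>M) \<longlonglongrightarrow> (\<integral>z. g z * G z \<partial>M)"
    if M: "interval_distribution M c" and G: "continuous_on UNIV G" for M G
  proof -
    interpret M: interval_distribution M c by (rule M)
    note [measurable] = borel_measurable_continuous_onI[OF G] borel_measurable_continuous_onI[OF cont(1)]
      borel_measurable_continuous_onI[OF continuous_on_poly[OF continuous_on_id]]
    show ?thesis
    \<comment> \<open>The approximation error is at most 1 for every \<open>n\<close>, which gives
      the dominating function.\<close>
    proof (rule integral_dominated_convergence[where w = "\<lambda>z. (sqrt (g z) + 1)\<^sup>2 * \<bar>G z\<bar>"])
      show "integrable M (\<lambda>z. (sqrt (g z) + 1)\<^sup>2 * \<bar>G z\<bar>)"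
        by (intro M.integrable_continuous continuous_intros cont(1) G)
      show "AE z in M. (\<lambda>n. (poly (q n) z)\<^sup>2 * G z) \<longlonglongrightarrow> g z * G z"
        using M.AE_interval
      proof eventually_elim
        case (elim z)
        have "(\<lambda>n. poly (q n) z - sqrt (g z)) \<longlonglongrightarrow> 0"
          by (rule Lim_null_comparison[OF _ LIMSEQ_inverse_real_of_nat])
             (use q[OF elim] in \<open>auto simp: inverse_eq_divide intro!: always_eventually less_imp_le\<close>)
        then have "(\<lambda>n. (poly (q n) z)\<^sup>2 * G z) \<longlonglongrightarrow> (sqrt (g z))\<^sup>2 * G z"
          by (intro tendsto_intros) (simp add: LIM_zero_iff)
        then show ?case by (simp add: g_nonneg)
      qed
      show "AE z in M. norm ((poly (q n) z)\<^sup>2 * G z) \<le> (sqrt (g z) + 1)\<^sup>2 * \<bar>G z\<bar>" for n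
        using M.AE_interval
      proof eventually_elim
        case (elim z)
        have "1 / real (Suc n) \<le> 1" by simp
        with q[OF elim, of n] have "\<bar>poly (q n) z\<bar> \<le> \<bar>sqrt (g z) + 1\<bar>"
          using g_nonneg[of z] real_sqrt_ge_zero[of "g z"] by linarith
        then have "(poly (q n) z)\<^sup>2 \<le> (sqrt (g z) + 1)\<^sup>2" by (rule abs_le_square_iff[THEN iffD1])
        then show ?case by (simp add: abs_mult mult_right_mono)
      qed
    qed measurable
  qed
  note lim = this
  show ?thesis
    by (rule LIMSEQ_le[OF lim[OF M1 cont(2)] lim[OF M2 cont(3)]]) (use le in blast)
qed

lemma continuous_on_cts_step [continuous_intros]:
  "a < b \<Longrightarrow> continuous_on S (cts_step a b)"
  by (rule continuous_on_subset[OF uniformly_continuous_imp_continuous[OF cts_step_uniformly_continuous]]) auto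

text \<open>Equal moments give equal integrals of polynomials, hence comparable integrals of a
  continuous step falling from 1 at \<open>a\<close> to 0 at \<open>b\<close>. The step lies between
  the indicators of the two half-lines, and right continuity removes the gap as \<open>b\<close>
  decreases to \<open>a\<close>.\<close>

lemma interval_distribution_eqI:
  assumes M1: "interval_distribution M1 c" and M2: "interval_distribution M2 c"
    and moments: "\<And>n. (\<integral>z. z ^ n \<partial>M1) = (\<integral>z. z ^ n \<partial>M2)"
  shows "M1 = M2"
proof -
  have le: "cdf M a \<le> cdf N a" if M: "interval_distribution M c" and N: "interval_distribution N c"
    and eq: "\<And>n. (\<integral>z. z ^ n \<partial>M) = (\<integral>z. z ^ n \<partial>N)" for M N a
  proof -
    interpret M: interval_distribution M c by (rule M)
    interpret N: interval_distribution N c by (rule N)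
    have "cdf M a \<le> cdf N b" if "a < b" for b
    proof -
      have "(\<integral>z. cts_step a b z * 1 \<partial>M) \<le> (\<integral>z. cts_step a b z * 1 \<partial>N)"
      proof (rule integral_le_of_poly_square[OF M N])
        show "(\<integral>z. (poly q z)\<^sup>2 * 1 \<partial>M) \<le> (\<integral>z. (poly q z)\<^sup>2 * 1 \<partial>N)" for q
          using M.integral_poly[of "q\<^sup>2"] N.integral_poly[of "q\<^sup>2"] by (simp add: eq)
        show "0 \<le> cts_step a b z" for z
          using that by (auto simp: cts_step_def)
      qed (use that in \<open>auto intro: continuous_on_cts_step\<close>)
      then show ?thesis
        using M.cdf_cts_step(1)[OF that] N.cdf_cts_step(2)[OF that] by simp
    qed
    then have "\<forall>\<^sub>F b in at_right a. cdf M a \<le> cdf N b"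
      by (auto simp: eventually_at_filter)
    then show ?thesis
      by (rule tendsto_lowerbound[OF N.cdf_is_right_cont[unfolded continuous_within]]) simp
  qed
  interpret M1: interval_distribution M1 c by (rule M1)
  interpret M2: interval_distribution M2 c by (rule M2)
  have "cdf M1 = cdf M2"
    by (intro ext antisym le M1 M2 moments moments[symmetric])
  then show ?thesis
    by (intro cdf_unique M1.real_distribution_axioms M2.real_distribution_axioms)
qed

text \<open>Normalising to a unit vector keeps \<open>M\<close> a probability distribution; the
  squared norm is carried outside the integral.\<close>

lemma (in positive_operator) spectral_distribution:
  obtains M where "interval_distribution M c"
    "\<And>p. (norm x)\<^sup>2 * (\<integral>z. poly p z \<partial>M) = fcalc p x \<bullet> x"
proof (cases "x = 0")
  case True
  \<comment> \<open>For the zero vector any distribution on the interval serves; a point mass is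
    chosen.\<close>
  have "interval_distribution (return borel 0) c"
    unfolding interval_distribution_def real_distribution_def real_distribution_axioms_def
      interval_distribution_axioms_def
    using c_pos by (auto simp: prob_space_return AE_return)
  then show ?thesis by (rule that) (simp add: True)
next
  case False
  define v where "v = sgn x"
  have v: "norm v = 1" "x = norm x *\<^sub>R v"
    using False by (simp_all add: v_def norm_sgn sgn_div_norm)
  obtain M
    where M: "real_distribution M" "AE z in M. z \<in> {0..c}"
      and moments: "\<And>k. (\<integral>z. z ^ k \<partial>M) = (T ^^ k) v \<bullet> v"
    using spectral_distribution_unit[OF v(1)] by blast
  from M have M': "interval_distribution M c"
    by (simp add: interval_distribution_def interval_distribution_axioms_def)
  then interpret interval_distribution M c .
  show ?thesis
  proof (rule that[OF M'])
    fix p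
    have "(\<integral>z. poly p z \<partial>M) = fcalc p v \<bullet> v"
      by (simp add: integral_poly moments fcalc_def inner_sum_left)
    moreover have "fcalc p x \<bullet> x = (norm x)\<^sup>2 * (fcalc p v \<bullet> v)"
      using linear_scale[OF linear_fcalc, of p "norm x" v] v(2)[symmetric]
      by (metis inner_scaleR mult.assoc power2_eq_square)
    ultimately show "(norm x)\<^sup>2 * (\<integral>z. poly p z \<partial>M) = fcalc p x \<bullet> x" by simp
  qed
qed

section \<open>Finitely supported functions\<close>

text \<open>The Laplacian and its polynomials preserve finite support, so this dense part of
  \<open>\<ell>^2\<close> suffices and all inner products are finite sums.\<close>

typedef 'a finsupp = "{f :: 'a \<Rightarrow> real. finite {x. f x \<noteq> 0}}"
  morphisms fval Abs_finsupp
  by (rule exI[of _ "\<lambda>_. 0"]) simp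

setup_lifting type_definition_finsupp

lemma finite_support [simp]: "finite {x. fval f x \<noteq> 0}"
  using fval by blast

lemma finsupp_eqI: "(\<And>x. fval f x = fval g x) \<Longrightarrow> f = g"
  by (simp add: fval_inject[symmetric] ext)

instantiation finsupp :: (type) real_vector
begin

lift_definition zero_finsupp :: "'a finsupp" is "\<lambda>_. 0" by simp

lift_definition plus_finsupp :: "'a finsupp \<Rightarrow> 'a finsupp \<Rightarrow> 'a finsupp" is "\<lambda>f g x. f x + g x"
  by (drule (1) finite_UnI, erule finite_subset[rotated]) auto

lift_definition uminus_finsupp :: "'a finsupp \<Rightarrow> 'a finsupp" is "\<lambda>f x. - f x"
  by simp

lift_definition minus_finsupp :: "'a finsupp \<Rightarrow> 'a finsupp \<Rightarrow> 'a finsupp" is "\<lambda>f g x. f x - g x"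
  by (drule (1) finite_UnI, erule finite_subset[rotated]) auto

lift_definition scaleR_finsupp :: "real \<Rightarrow> 'a finsupp \<Rightarrow> 'a finsupp" is "\<lambda>r f x. r * f x"
  by (erule finite_subset[rotated]) auto

instance
  by standard (transfer; simp add: algebra_simps)+

end

lemma fval_simps [simp]:
  "fval 0 x = 0" "fval (f + g) x = fval f x + fval g x" "fval (- f) x = - fval f x"
  "fval (f - g) x = fval f x - fval g x" "fval (r *\<^sub>R f) x = r * fval f x"
  by (transfer; simp)+

lemma fval_sum [simp]: "fval (\<Sum>i\<in>I. f i) x = (\<Sum>i\<in>I. fval (f i) x)"
  by (induction I rule: infinite_finite_induct) auto

instantiation finsupp :: (type) real_inner
begin

definition inner_finsupp :: "'a finsupp \<Rightarrow> 'a finsupp \<Rightarrow> real" where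
  "inner_finsupp f g = (\<Sum>x\<in>{x. fval f x \<noteq> 0}. fval f x * fval g x)"

definition norm_finsupp :: "'a finsupp \<Rightarrow> real" where
  "norm_finsupp f = sqrt (f \<bullet> f)"

definition dist_finsupp :: "'a finsupp \<Rightarrow> 'a finsupp \<Rightarrow> real" where
  "dist_finsupp f g = norm (f - g)"

definition sgn_finsupp :: "'a finsupp \<Rightarrow> 'a finsupp" where
  "sgn_finsupp f = f /\<^sub>R norm f"

definition uniformity_finsupp :: "('a finsupp \<times> 'a finsupp) filter" where
  "uniformity_finsupp = (INF e\<in>{0<..}. principal {(x, y). dist x y < e})"

definition open_finsupp :: "'a finsupp set \<Rightarrow> bool" where
  "open_finsupp U \<longleftrightarrow> (\<forall>x\<in>U. \<forall>\<^sub>F (x', y) in uniformity. x' = x \<longrightarrow> y \<in> U)"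

text \<open>Any finite set containing the common support may index the sum, which spares comparing
  the two supports in later calculations.\<close>

lemma inner_finsupp_eq_sum:
  fixes f g :: "'a finsupp"
  assumes "finite X" "\<And>x. fval f x \<noteq> 0 \<Longrightarrow> fval g x \<noteq> 0 \<Longrightarrow> x \<in> X"
  shows "f \<bullet> g = (\<Sum>x\<in>X. fval f x * fval g x)"
proof -
  have "f \<bullet> g = (\<Sum>x\<in>{x. fval f x \<noteq> 0} \<inter> X. fval f x * fval g x)"
    unfolding inner_finsupp_def using assms by (intro sum.mono_neutral_right) auto
  also have "\<dots> = (\<Sum>x\<in>X. fval f x * fval g x)"
    using assms by (intro sum.mono_neutral_left) auto
  finally show ?thesis .
qed

instance
proof
  fix f g h :: "'a finsupp" and r :: real
  show "f \<bullet> g = g \<bullet> f"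
    unfolding inner_finsupp_def[of g f]
    by (subst inner_finsupp_eq_sum[of "{x. fval g x \<noteq> 0}"]) (auto simp: mult.commute)
  let ?X = "{x. fval f x \<noteq> 0} \<union> {x. fval g x \<noteq> 0}"
  show "(f + g) \<bullet> h = f \<bullet> h + g \<bullet> h"
    by (subst (1 2 3) inner_finsupp_eq_sum[of ?X]) (auto simp: distrib_right sum.distrib)
  show "(r *\<^sub>R f) \<bullet> g = r * (f \<bullet> g)"
    by (subst (1 2) inner_finsupp_eq_sum[of ?X]) (auto simp: sum_distrib_left mult.assoc)
  show "0 \<le> f \<bullet> f"
    by (auto simp: inner_finsupp_def intro: sum_nonneg)
  show "f \<bullet> f = 0 \<longleftrightarrow> f = 0"
    by (auto simp: inner_finsupp_def sum_nonneg_eq_0_iff intro!: finsupp_eqI)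
qed (simp_all add: norm_finsupp_def dist_finsupp_def sgn_finsupp_def uniformity_finsupp_def open_finsupp_def)

end

lift_definition delta :: "'a \<Rightarrow> 'a finsupp" is "\<lambda>a x. of_bool (x = a)"
  by simp

lemma fval_delta [simp]: "fval (delta a) x = of_bool (x = a)"
  by transfer simp

lemma inner_delta [simp]: "f \<bullet> delta a = fval f a"
  by (subst inner_finsupp_eq_sum[of "{a}"]) (auto split: if_splits)

lemma norm_delta [simp]: "norm (delta a) = 1"
  by (simp add: norm_eq_sqrt_inner)

lemma finsupp_eq_sum_delta:
  assumes "finite X" "\<And>x. fval f x \<noteq> 0 \<Longrightarrow> x \<in> X"
  shows "f = (\<Sum>x\<in>X. fval f x *\<^sub>R delta x)"
  using assms by (intro finsupp_eqI) (auto simp: of_bool_def if_distrib cong: if_cong)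

text \<open>The value is 0 when \<open>\<sigma>\<close> is not injective, since then finiteness of the support may be lost.\<close>

lift_definition pullback :: "'a set \<Rightarrow> ('a \<Rightarrow> 'a) \<Rightarrow> 'a finsupp \<Rightarrow> 'a finsupp"
  is "\<lambda>C \<sigma> f x. if x \<in> C \<and> inj_on \<sigma> C then f (\<sigma> x) else 0"
proof -
  fix C :: "'a set" and \<sigma> :: "'a \<Rightarrow> 'a" and f :: "'a \<Rightarrow> real"
  assume f: "finite {x. f x \<noteq> 0}"
  show "finite {x. (if x \<in> C \<and> inj_on \<sigma> C then f (\<sigma> x) else 0) \<noteq> 0}"
  proof (cases "inj_on \<sigma> C")
    case True
    have "finite (\<sigma> -` {x. f x \<noteq> 0} \<inter> C)" by (rule finite_vimage_IntI[OF f True])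
    then show ?thesis by (rule finite_subset[rotated]) auto
  qed simp
qed

lemma fval_pullback [simp]:
  "inj_on \<sigma> C \<Longrightarrow> fval (pullback C \<sigma> f) x = (if x \<in> C then fval f (\<sigma> x) else 0)"
  by transfer simp

lemma linear_pullback: "linear (pullback C \<sigma>)"
  by (auto simp: linear_iff intro!: finsupp_eqI; transfer; simp)

text \<open>Change of variables by a bijection of \<open>C\<close>: the adjoint of a pullback is the
  pullback along the inverse.\<close>

lemma inner_pullback:
  assumes "\<And>x. x \<in> C \<Longrightarrow> \<sigma> x \<in> C" "\<And>x. x \<in> C \<Longrightarrow> \<tau> x \<in> C"
    and "\<And>x. x \<in> C \<Longrightarrow> \<tau> (\<sigma> x) = x" "\<And>x. x \<in> C \<Longrightarrow> \<sigma> (\<tau> x) = x"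
  shows "pullback C \<sigma> f \<bullet> g = f \<bullet> pullback C \<tau> g"
proof -
  have "inj_on \<sigma> C" by (rule inj_on_inverseI[where g = \<tau>]) (rule assms)
  moreover have "inj_on \<tau> C" by (rule inj_on_inverseI[where g = \<sigma>]) (rule assms)
  ultimately have inj: "inj_on \<sigma> C" "inj_on \<tau> C" by blast+
  let ?Y = "{y \<in> C. fval f y \<noteq> 0}"
  have fin: "finite ?Y" by (rule finite_subset[of _ "{x. fval f x \<noteq> 0}"]) auto
  have fin': "finite (\<tau> ` ?Y)" using fin by simp
  have sub: "x \<in> \<tau> ` ?Y" if "x \<in> C" "fval f (\<sigma> x) \<noteq> 0" for x
    using that assms by (intro image_eqI[of _ _ "\<sigma> x"]) auto
  have "pullback C \<sigma> f \<bullet> g = (\<Sum>x\<in>\<tau> ` ?Y. fval f (\<sigma> x) * fval g x)"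
    using fin' sub assms inj
    by (subst inner_finsupp_eq_sum[of "\<tau> ` ?Y"]) (auto split: if_splits intro!: sum.cong)
  also have "\<dots> = (\<Sum>y\<in>?Y. fval f y * fval g (\<tau> y))"
    using assms inj by (subst sum.reindex) (auto intro: inj_on_subset)
  also have "\<dots> = f \<bullet> pullback C \<tau> g"
    using fin inj by (subst inner_finsupp_eq_sum[of ?Y]) (auto split: if_splits intro!: sum.cong)
  finally show ?thesis .
qed

lemma pullback_pullback:
  assumes "inj_on \<sigma> C" "inj_on \<tau> C" "\<And>x. x \<in> C \<Longrightarrow> \<sigma> x \<in> C"
    and "\<And>x. x \<in> C \<Longrightarrow> \<rho> x = \<tau> (\<sigma> x)"
  shows "pullback C \<sigma> (pullback C \<tau> f) = pullback C \<rho> f"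
proof -
  have "inj_on \<rho> C"
    using assms by (auto simp: inj_on_def)
  then show ?thesis using assms by (intro finsupp_eqI) auto
qed

text \<open>The adjoint times the pullback is restriction to \<open>C\<close>, a self-adjoint
  idempotent and thus a contraction by Cauchy-Schwarz. Values outside \<open>C\<close> are lost, so
  only an inequality holds in general.\<close>

lemma norm_pullback_le:
  assumes "\<And>x. x \<in> C \<Longrightarrow> \<sigma> x \<in> C" "\<And>x. x \<in> C \<Longrightarrow> \<tau> x \<in> C"
    and "\<And>x. x \<in> C \<Longrightarrow> \<tau> (\<sigma> x) = x" "\<And>x. x \<in> C \<Longrightarrow> \<sigma> (\<tau> x) = x"
  shows "norm (pullback C \<sigma> f) \<le> norm f"
proof -
  let ?P = "pullback C id"
  have "inj_on \<sigma> C" by (rule inj_on_inverseI[where g = \<tau>]) (rule assms)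
  moreover have "inj_on \<tau> C" by (rule inj_on_inverseI[where g = \<sigma>]) (rule assms)
  ultimately have inj: "inj_on \<sigma> C" "inj_on \<tau> C" by blast+
  have *: "(norm (pullback C \<sigma> f))\<^sup>2 = f \<bullet> ?P f"
  proof -
    have "(norm (pullback C \<sigma> f))\<^sup>2 = f \<bullet> pullback C \<tau> (pullback C \<sigma> f)"
      unfolding power2_norm_eq_inner by (rule inner_pullback) (rule assms; assumption)+
    also have "pullback C \<tau> (pullback C \<sigma> f) = ?P f"
      by (rule pullback_pullback) (auto simp: inj assms)
    finally show ?thesis .
  qed
  have "(norm (?P f))\<^sup>2 = f \<bullet> ?P f"
    unfolding power2_norm_eq_inner
    by (subst inner_pullback[of C id id]) (auto simp: pullback_pullback[where \<rho> = id])
  also have "\<dots> \<le> norm f * norm (?P f)" by (rule norm_cauchy_schwarz)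
  finally have "norm (?P f) \<le> norm f"
    by (cases "norm (?P f) = 0") (auto simp: power2_eq_square)
  have "(norm (pullback C \<sigma> f))\<^sup>2 \<le> norm f * norm (?P f)"
    unfolding * by (rule norm_cauchy_schwarz)
  also have "\<dots> \<le> (norm f)\<^sup>2"
    using \<open>norm (?P f) \<le> norm f\<close> by (simp add: power2_eq_square mult_left_mono)
  finally show ?thesis by (rule power2_le_imp_le) simp
qed

section \<open>The Laplacian of a Cayley graph\<close>

locale cayley_graph = group G for G (structure) +
  fixes S :: "'a set"
  assumes finite_S [simp]: "finite S"
    and S_nonempty: "S \<noteq> {}"
    and S_carrier: "S \<subseteq> carrier G"
    and S_inv: "s \<in> S \<Longrightarrow> inv s \<in> S"
begin

text \<open>Functions live on the whole type, which may exceed the carrier; restriction to the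
  carrier takes the place of the identity operator.\<close>

abbreviation P :: "'a finsupp \<Rightarrow> 'a finsupp" where "P \<equiv> pullback (carrier G) id"

definition R :: "'a \<Rightarrow> 'a finsupp \<Rightarrow> 'a finsupp" where "R a = pullback (carrier G) (\<lambda>x. x \<otimes> a)"

definition L :: "'a \<Rightarrow> 'a finsupp \<Rightarrow> 'a finsupp" where "L a = pullback (carrier G) (\<lambda>x. a \<otimes> x)"

definition lap :: "'a finsupp \<Rightarrow> 'a finsupp" where
  "lap f = real (card S) *\<^sub>R P f - (\<Sum>s\<in>S. R s f)"

lemma S_in_carrier [simp]: "s \<in> S \<Longrightarrow> s \<in> carrier G"
  using S_carrier by blast

lemma inj_right_mult: "a \<in> carrier G \<Longrightarrow> inj_on (\<lambda>x. x \<otimes> a) (carrier G)"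
  by (simp add: inj_on_def)

lemma inj_left_mult: "a \<in> carrier G \<Longrightarrow> inj_on (\<lambda>x. a \<otimes> x) (carrier G)"
  by (simp add: inj_on_def)

lemma fval_R: "a \<in> carrier G \<Longrightarrow> fval (R a f) x = (if x \<in> carrier G then fval f (x \<otimes> a) else 0)"
  by (simp add: R_def inj_right_mult)

lemma fval_L: "a \<in> carrier G \<Longrightarrow> fval (L a f) x = (if x \<in> carrier G then fval f (a \<otimes> x) else 0)"
  by (simp add: L_def inj_left_mult)

lemma linear_R: "linear (R a)" and linear_L: "linear (L a)"
  by (simp_all add: R_def L_def linear_pullback)

lemma P_P [simp]: "P (P f) = P f"
  by (simp add: finsupp_eqI)

lemma P_R [simp]: "a \<in> carrier G \<Longrightarrow> P (R a f) = R a f"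
  by (rule finsupp_eqI) (simp add: fval_R)

lemma R_P [simp]: "a \<in> carrier G \<Longrightarrow> R a (P f) = R a f"
  by (rule finsupp_eqI) (simp add: fval_R)

lemma R_R: "a \<in> carrier G \<Longrightarrow> b \<in> carrier G \<Longrightarrow> R a (R b f) = R (a \<otimes> b) f"
  by (rule finsupp_eqI) (simp add: fval_R m_assoc)

lemma R_one: "R \<one> f = P f"
  by (rule finsupp_eqI) (simp add: fval_R)

lemma R_L: "a \<in> carrier G \<Longrightarrow> b \<in> carrier G \<Longrightarrow> R a (L b f) = L b (R a f)"
  by (rule finsupp_eqI) (simp add: fval_R fval_L m_assoc)

lemma P_L: "a \<in> carrier G \<Longrightarrow> P (L a f) = L a (P f)"
  by (rule finsupp_eqI) (simp add: fval_L)

lemma inner_P: "P f \<bullet> g = f \<bullet> P g"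
  by (rule inner_pullback) auto

lemma inner_R: "a \<in> carrier G \<Longrightarrow> R a f \<bullet> g = f \<bullet> R (inv a) g"
  unfolding R_def by (rule inner_pullback) (auto simp: m_assoc)

lemma inner_L: "a \<in> carrier G \<Longrightarrow> L a f \<bullet> g = f \<bullet> L (inv a) g"
  unfolding L_def by (rule inner_pullback) (auto simp flip: m_assoc)

lemma norm_P_le: "norm (P f) \<le> norm f"
  by (rule norm_pullback_le[of _ _ id]) auto

lemma norm_R_le: "a \<in> carrier G \<Longrightarrow> norm (R a f) \<le> norm f"
  unfolding R_def by (rule norm_pullback_le[of _ _ "\<lambda>x. x \<otimes> inv a"]) (auto simp: m_assoc)

lemma norm_L_le: "a \<in> carrier G \<Longrightarrow> norm (L a f) \<le> norm f"
  unfolding L_def by (rule norm_pullback_le[of _ _ "\<lambda>x. inv a \<otimes> x"]) (auto simp flip: m_assoc)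

lemma norm_P_square: "(norm (P f))\<^sup>2 = f \<bullet> P f"
  by (simp add: power2_norm_eq_inner inner_P)

lemma norm_R_square: "a \<in> carrier G \<Longrightarrow> (norm (R a f))\<^sup>2 = f \<bullet> P f"
  by (simp add: power2_norm_eq_inner inner_R R_R R_one)

lemma L_delta: "a \<in> carrier G \<Longrightarrow> b \<in> carrier G \<Longrightarrow> L a (delta b) = delta (inv a \<otimes> b)"
  by (rule finsupp_eqI) (auto simp: fval_L inv_solve_left' simp flip: m_assoc)

lemma P_delta: "a \<in> carrier G \<Longrightarrow> P (delta a) = delta a"
  by (rule finsupp_eqI) auto

lemma fval_lap:
  "fval (lap f) x = (if x \<in> carrier G then real (card S) * fval f x - (\<Sum>s\<in>S. fval f (x \<otimes> s)) else 0)"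
  by (simp add: lap_def fval_R)

lemma linear_lap: "linear lap"
  unfolding lap_def
  by (intro linear_compose_sub linear_compose_scale_right linear_compose_sum ballI linear_R linear_pullback)

text \<open>The Laplacian is made of right translations, and these commute with left ones by
  associativity.\<close>

lemma lap_L: "a \<in> carrier G \<Longrightarrow> L a (lap f) = lap (L a f)"
  by (simp add: lap_def linear_diff[OF linear_L] linear_scale[OF linear_L] linear_sum[OF linear_L] R_L P_L)

lemma lap_P: "P (lap f) = lap (P f)"
  by (rule finsupp_eqI) (simp add: fval_lap)

text \<open>The Dirichlet form. Translation preserves the norm on the carrier, so expanding each
  square leaves twice the difference of two inner products; the factor 2 counts each edge from both
  ends.\<close>

lemma sum_norm_gradient: "(\<Sum>s\<in>S. (norm (P f - R s f))\<^sup>2) = 2 * (lap f \<bullet> f)"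
proof -
  have "(norm (P f - R s f))\<^sup>2 = 2 * (P f \<bullet> f) - 2 * (R s f \<bullet> f)" if "s \<in> S" for s
  proof -
    have "P f \<bullet> R s f = R s f \<bullet> f"
      using that by (subst inner_P) (simp add: inner_commute)
    then have "(norm (P f - R s f))\<^sup>2 = (norm (P f))\<^sup>2 + (norm (R s f))\<^sup>2 - 2 * (R s f \<bullet> f)"
      by (simp add: power2_norm_eq_inner inner_diff inner_commute)
    also have "\<dots> = 2 * (P f \<bullet> f) - 2 * (R s f \<bullet> f)"
      using that by (simp add: norm_P_square norm_R_square inner_commute)
    finally show ?thesis .
  qed
  then show ?thesis
    by (simp add: lap_def inner_diff inner_sum_left sum_subtractf sum_distrib_left)
qed

sublocale positive_operator lap "2 * real (card S)"
proof (rule positive_operator.intro)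
  show "linear lap" by (rule linear_lap)
  show "lap f \<bullet> g = f \<bullet> lap g" for f g
  proof -
    have "(\<Sum>s\<in>S. R s f \<bullet> g) = (\<Sum>s\<in>S. f \<bullet> R (inv s) g)"
      by (simp add: inner_R)
    \<comment> \<open>Symmetry of the operator: inversion permutes the generating set.\<close>
    also have "\<dots> = (\<Sum>s\<in>S. f \<bullet> R s g)"
      by (rule sum.reindex_bij_witness[of _ "\<lambda>s. inv s" "\<lambda>s. inv s"]) (auto simp: S_inv)
    finally show ?thesis
      by (simp add: lap_def inner_diff inner_sum_left inner_sum_right inner_P)
  qed
  have "0 \<le> (\<Sum>s\<in>S. (norm (P f - R s f))\<^sup>2)" for f
    by (intro sum_nonneg) auto
  then show "0 \<le> lap f \<bullet> f" for f
    by (simp add: sum_norm_gradient)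
  show "lap f \<bullet> f \<le> 2 * real (card S) * (f \<bullet> f)" for f
  proof -
    have "P f \<bullet> f \<le> f \<bullet> f"
      using power_mono[OF norm_P_le[of f], of 2] unfolding norm_P_square
      by (simp add: power2_norm_eq_inner inner_commute)
    then have "real (card S) * (P f \<bullet> f) \<le> real (card S) * (f \<bullet> f)"
      by (intro mult_left_mono) auto
    moreover have "(\<Sum>s\<in>S. - (R s f \<bullet> f)) \<le> (\<Sum>s\<in>S. f \<bullet> f)"
    proof (intro sum_mono)
      fix s assume "s \<in> S"
      have "- (R s f \<bullet> f) \<le> norm (R s f) * norm f"
        using Cauchy_Schwarz_ineq2[of "R s f" f] by linarith
      also have "\<dots> \<le> norm f * norm f"
        using \<open>s \<in> S\<close> by (intro mult_right_mono norm_R_le) auto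
      finally show "- (R s f \<bullet> f) \<le> f \<bullet> f"
        by (simp add: power2_norm_eq_inner flip: power2_eq_square)
    qed
    ultimately show ?thesis
      by (simp add: lap_def inner_diff inner_sum_left sum_negf)
  qed
  show "0 < 2 * real (card S)"
    using S_nonempty by (simp add: card_gt_0_iff)
qed

text \<open>An analytic substitute for word length: \<open>sqrt (2 * (lap f \<bullet> f))\<close> is
  the norm of the gradient, and \<open>d\<close> bounds the ratio by which translation by
  \<open>g\<close> can move any \<open>f\<close> against it.\<close>

definition displacement_le :: "'a \<Rightarrow> real \<Rightarrow> bool" where
  "displacement_le g d \<longleftrightarrow> 0 \<le> d \<and> (\<forall>f. norm (P f - R g f) \<le> d * sqrt (2 * (lap f \<bullet> f)))"

lemma displacement_le_mono: "displacement_le g d \<Longrightarrow> d \<le> d' \<Longrightarrow> displacement_le g d'"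
  unfolding displacement_le_def
  by (auto intro: order_trans[OF _ mult_right_mono] simp: nonneg)

lemma displacement_le_one: "displacement_le \<one> 0"
  by (simp add: displacement_le_def R_one)

lemma displacement_le_generator:
  assumes "s \<in> S"
  shows "displacement_le s 1"
  unfolding displacement_le_def
proof (intro conjI allI)
  fix f
  have "(norm (P f - R s f))\<^sup>2 \<le> (\<Sum>s\<in>S. (norm (P f - R s f))\<^sup>2)"
    using assms by (intro member_le_sum) auto
  then show "norm (P f - R s f) \<le> 1 * sqrt (2 * (lap f \<bullet> f))"
    by (simp add: sum_norm_gradient real_le_rsqrt)
qed simp

text \<open>Translating in two stages, the second difference is carried by the contraction
  \<open>R g\<close>; hence displacement is subadditive, as word length is.\<close>

lemma displacement_le_mult:
  assumes "g \<in> carrier G" "h \<in> carrier G" "displacement_le g a" "displacement_le h b"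
  shows "displacement_le (g \<otimes> h) (a + b)"
  unfolding displacement_le_def
proof (intro conjI allI)
  show "0 \<le> a + b" using assms by (simp add: displacement_le_def)
  fix f
  have "P f - R (g \<otimes> h) f = (P f - R g f) + R g (P f - R h f)"
    using assms by (simp add: linear_diff[OF linear_R] R_R)
  also have "norm \<dots> \<le> norm (P f - R g f) + norm (P f - R h f)"
    using assms(1) by (intro norm_triangle_mono norm_R_le order_refl)
  also have "\<dots> \<le> (a + b) * sqrt (2 * (lap f \<bullet> f))"
    using assms(3,4) by (auto simp: displacement_le_def distrib_right intro: add_mono)
  finally show "norm (P f - R (g \<otimes> h) f) \<le> (a + b) * sqrt (2 * (lap f \<bullet> f))" .
qed

text \<open>The kernel of \<open>q(lap)\<close> is symmetric and left invariant, so its values at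
  the identity column depend on a group element only up to inversion.\<close>

lemma fval_fcalc_one_inv:
  assumes "g \<in> carrier G"
  shows "fval (fcalc q (delta \<one>)) (inv g) = fval (fcalc q (delta \<one>)) g"
proof -
  let ?u = "fcalc q (delta \<one>)"
  have "fval ?u g = ?u \<bullet> L (inv g) (delta \<one>)"
    using assms by (simp add: L_delta)
  also have "\<dots> = L g ?u \<bullet> delta \<one>"
    using assms by (simp only: inner_L)
  also have "L g ?u = fcalc q (delta (inv g))"
    using assms by (subst fcalc_commute) (auto simp: linear_L lap_L L_delta)
  also have "\<dots> \<bullet> delta \<one> = delta (inv g) \<bullet> ?u" by (rule fcalc_sym)
  also have "\<dots> = fval ?u (inv g)" by (subst inner_commute) (rule inner_delta)
  finally show ?thesis by simp
qed

lemma norm_fcalc_delta_le: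
  assumes "g \<in> carrier G"
  shows "norm (fcalc q (delta g)) \<le> norm (fcalc q (delta \<one>))"
proof -
  have "fcalc q (delta g) = L (inv g) (fcalc q (delta \<one>))"
    using assms by (subst fcalc_commute) (auto simp: linear_L lap_L L_delta)
  then show ?thesis using assms by (simp add: norm_L_le)
qed

text \<open>Traciality: inversion turns right translations of \<open>q(\<Delta>)\<delta>\<close> into left translations, which
  commute with \<open>q(\<Delta>)\<close>.\<close>

lemma norm_sum_R_fcalc_le:
  assumes "A \<subseteq> carrier G"
  shows "norm (\<Sum>a\<in>A. R a (fcalc q (delta \<one>))) \<le> norm (fcalc q (\<Sum>a\<in>A. delta a))"
proof -
  let ?u = "fcalc q (delta \<one>)" and ?J = "pullback (carrier G) (\<lambda>x. inv x)"
  have inj: "inj_on (\<lambda>x. inv x) (carrier G)"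
    by (rule inj_on_inverseI[where g = "\<lambda>x. inv x"]) simp
  have R: "R a ?u = ?J (L (inv a) ?u)" if "a \<in> A" for a
  proof (rule finsupp_eqI)
    fix x
    have a: "a \<in> carrier G" using that assms by blast
    show "fval (R a ?u) x = fval (?J (L (inv a) ?u)) x"
      using fval_fcalc_one_inv[of "x \<otimes> a" q] a by (auto simp: inj fval_R fval_L inv_mult_group)
  qed
  have "(\<Sum>a\<in>A. R a ?u) = ?J (\<Sum>a\<in>A. L (inv a) ?u)"
    by (simp add: R linear_sum[OF linear_pullback])
  also have "norm \<dots> \<le> norm (\<Sum>a\<in>A. L (inv a) ?u)"
    by (rule norm_pullback_le[of _ _ "\<lambda>x. inv x"]) auto
  also have "(\<Sum>a\<in>A. L (inv a) ?u) = (\<Sum>a\<in>A. fcalc q (delta a))"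
  proof (rule sum.cong)
    fix a assume "a \<in> A"
    then have "a \<in> carrier G" using assms by blast
    then show "L (inv a) ?u = fcalc q (delta a)"
      by (subst fcalc_commute) (auto simp: linear_L lap_L L_delta)
  qed simp
  also have "\<dots> = fcalc q (\<Sum>a\<in>A. delta a)"
    by (simp add: linear_sum[OF linear_fcalc])
  finally show ?thesis .
qed

lemma norm_sum_delta: "finite A \<Longrightarrow> (norm (\<Sum>a\<in>A. delta a))\<^sup>2 = real (card A)"
  by (simp add: power2_norm_eq_inner inner_sum_right of_bool_def)

text \<open>With \<open>v\<close> the average of the right translates of \<open>u\<close> over
  \<open>A\<close>, the displacement controls \<open>u - v\<close> by the energy and traciality
  controls \<open>v\<close>. The square of the sum is at most twice the sum of the squares; the
  other factor 2 in \<open>4 * d\<^sup>2\<close> comes from the Dirichlet form.\<close>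

lemma norm_fcalc_one_le:
  fixes q d
  assumes "finite A" "A \<noteq> {}" "A \<subseteq> carrier G" "\<And>a. a \<in> A \<Longrightarrow> displacement_le a d"
  defines "h \<equiv> \<Sum>a\<in>A. delta a"
  assumes u_def: "u = fcalc q (delta \<one>)"
  shows "(norm u)\<^sup>2 \<le> 4 * d\<^sup>2 * (lap u \<bullet> u) + 2 / (real (card A))\<^sup>2 * (norm (fcalc q h))\<^sup>2"
proof -
  let ?n = "real (card A)"
  have n: "?n > 0" using assms by (simp add: card_gt_0_iff)
  let ?v = "(1 / ?n) *\<^sub>R (\<Sum>a\<in>A. R a u)"
  have d: "0 \<le> d" using assms by (auto simp: displacement_le_def)
  have Pu: "P u = u"
    unfolding u_def by (subst fcalc_commute) (auto simp: linear_pullback lap_P P_delta)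
  have "?n *\<^sub>R (u - ?v) = (\<Sum>a\<in>A. u - R a u)"
    using n by (simp add: sum_subtractf scaleR_diff_right scaleR_sum_left[symmetric] sum_constant_scaleR)
  then have "?n * norm (u - ?v) = norm (\<Sum>a\<in>A. u - R a u)"
    by (metis abs_of_nat norm_scaleR)
  also have "\<dots> \<le> (\<Sum>a\<in>A. norm (u - R a u))" by (rule norm_sum)
  also have "\<dots> \<le> (\<Sum>a\<in>A. d * sqrt (2 * (lap u \<bullet> u)))"
  proof (rule sum_mono)
    fix a assume "a \<in> A"
    then have "norm (P u - R a u) \<le> d * sqrt (2 * (lap u \<bullet> u))"
      using assms(4) unfolding displacement_le_def by blast
    then show "norm (u - R a u) \<le> d * sqrt (2 * (lap u \<bullet> u))" by (simp add: Pu)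
  qed
  also have "\<dots> = ?n * (d * sqrt (2 * (lap u \<bullet> u)))" by simp
  finally have "norm (u - ?v) \<le> d * sqrt (2 * (lap u \<bullet> u))" using n by simp
  then have "(norm (u - ?v))\<^sup>2 \<le> (d * sqrt (2 * (lap u \<bullet> u)))\<^sup>2" by (intro power_mono) auto
  then have 1: "(norm (u - ?v))\<^sup>2 \<le> d\<^sup>2 * (2 * (lap u \<bullet> u))"
    by (simp add: power_mult_distrib nonneg)
  have "norm ?v \<le> 1 / ?n * norm (fcalc q h)"
    using norm_sum_R_fcalc_le[OF assms(3), of q] by (simp add: h_def u_def divide_right_mono)
  then have "(norm ?v)\<^sup>2 \<le> (1 / ?n * norm (fcalc q h))\<^sup>2" by (intro power_mono) auto
  then have 2: "(norm ?v)\<^sup>2 \<le> 1 / ?n\<^sup>2 * (norm (fcalc q h))\<^sup>2"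
    by (simp add: power_mult_distrib power_divide)
  have "norm u \<le> norm (u - ?v) + norm ?v"
    using norm_triangle_ineq[of "u - ?v" ?v] by simp
  then have "(norm u)\<^sup>2 \<le> (norm (u - ?v) + norm ?v)\<^sup>2" by (intro power_mono) auto
  also have "\<dots> \<le> 2 * (norm (u - ?v))\<^sup>2 + 2 * (norm ?v)\<^sup>2"
    using sum_squares_bound[of "norm (u - ?v)" "norm ?v"]
    by (simp add: power2_sum)
  finally show ?thesis using 1 2 by linarith
qed

text \<open>Expanding \<open>h\<close> in point masses, left invariance bounds the image of each one
  by that at the identity, and Cauchy-Schwarz costs the factor \<open>card \<Omega>\<close>.\<close>

lemma norm_fcalc_le_support:
  assumes "finite \<Omega>" "\<Omega> \<subseteq> carrier G" "\<And>x. fval h x \<noteq> 0 \<Longrightarrow> x \<in> \<Omega>"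
  shows "(norm (fcalc q h))\<^sup>2 \<le> real (card \<Omega>) * ((norm h)\<^sup>2 * (norm (fcalc q (delta \<one>)))\<^sup>2)"
proof -
  let ?u = "norm (fcalc q (delta \<one>))"
  have "fcalc q h = (\<Sum>x\<in>\<Omega>. fval h x *\<^sub>R fcalc q (delta x))"
    by (subst finsupp_eq_sum_delta[OF assms(1,3)])
       (simp_all add: linear_sum[OF linear_fcalc] linear_scale[OF linear_fcalc])
  then have "norm (fcalc q h) \<le> (\<Sum>x\<in>\<Omega>. norm (fval h x *\<^sub>R fcalc q (delta x)))"
    by (simp only: norm_sum)
  also have "\<dots> \<le> (\<Sum>x\<in>\<Omega>. \<bar>fval h x\<bar> * ?u)"
    using assms(2) by (auto intro!: sum_mono mult_left_mono norm_fcalc_delta_le)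
  finally have "(norm (fcalc q h))\<^sup>2 \<le> (\<Sum>x\<in>\<Omega>. \<bar>fval h x\<bar> * ?u)\<^sup>2"
    by (intro power_mono) auto
  also have "\<dots> \<le> real (card \<Omega>) * (\<Sum>x\<in>\<Omega>. (\<bar>fval h x\<bar> * ?u)\<^sup>2)"
    using Cauchy_Schwarz_ineq_sum[of "\<lambda>_. 1" "\<lambda>x. \<bar>fval h x\<bar> * ?u" \<Omega>] by simp
  also have "(\<Sum>x\<in>\<Omega>. (\<bar>fval h x\<bar> * ?u)\<^sup>2) = (norm h)\<^sup>2 * ?u\<^sup>2"
    unfolding power2_norm_eq_inner[of h]
    by (simp add: inner_finsupp_eq_sum[OF assms(1,3)] power_mult_distrib sum_distrib_right
        flip: power2_eq_square)
  finally show ?thesis .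
qed

section \<open>Bounds on the spectral distribution function of the identity vector\<close>

context
  fixes M :: "real measure"
  assumes M: "interval_distribution M (2 * real (card S))"
    and spectral: "\<And>p. (\<integral>z. poly p z \<partial>M) = fcalc p (delta \<one>) \<bullet> delta \<one>"
begin

interpretation M: interval_distribution M "2 * real (card S)" by (rule M)

text \<open>In terms of spectral measures \<open>norm_fcalc_one_le\<close> bounds the integral of
  \<open>q^2 (1 - 4 d^2 z)\<close> against \<open>M\<close> by \<open>2 / card A\<close> times that
  of \<open>q^2\<close> against the normalised measure \<open>N\<close> of the indicator of
  \<open>A\<close>. A cut-off falling from 1 to 0 between \<open>E\<close> and \<open>2 * E\<close>
  then replaces \<open>q^2\<close>.\<close>

lemma cdf_le_of_displacement:
  assumes A: "finite A" "A \<noteq> {}" "A \<subseteq> carrier G" "\<And>a. a \<in> A \<Longrightarrow> displacement_le a d"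
    and E: "0 < E" "16 * d\<^sup>2 * E \<le> 1"
  shows "cdf M E \<le> 4 / real (card A)"
proof -
  let ?n = "real (card A)" and ?h = "\<Sum>a\<in>A. delta a" and ?g = "cts_step E (2 * E)"
  have n: "?n > 0" using A by (simp add: card_gt_0_iff)
  have E2: "E < 2 * E" using E by simp
  obtain N where N: "interval_distribution N (2 * real (card S))"
    and N_spectral: "\<And>p. (norm ?h)\<^sup>2 * (\<integral>z. poly p z \<partial>N) = fcalc p ?h \<bullet> ?h"
    using spectral_distribution by blast
  interpret N: interval_distribution N "2 * real (card S)" by (rule N)
  have "(\<integral>z. ?g z * (1 - 4 * d\<^sup>2 * z) \<partial>M) \<le> (\<integral>z. ?g z * (2 / ?n) \<partial>N)"
  proof (rule integral_le_of_poly_square[OF M N])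
    fix q :: "real poly"
    define u where "u = fcalc q (delta \<one>)"
    have X: "fcalc (q * ([:0, 1:] * q)) (delta \<one>) = fcalc q (lap u)"
      by (simp only: fcalc_mult fcalc_X u_def)
    have "(\<integral>z. (poly q z)\<^sup>2 * (1 - 4 * d\<^sup>2 * z) \<partial>M)
        = (\<integral>z. poly (q\<^sup>2) z - 4 * d\<^sup>2 * poly (q * ([:0, 1:] * q)) z \<partial>M)"
      by (simp add: algebra_simps power2_eq_square)
    also have "\<dots> = (\<integral>z. poly (q\<^sup>2) z \<partial>M) - 4 * d\<^sup>2 * (\<integral>z. poly (q * ([:0, 1:] * q)) z \<partial>M)"
    proof -
      have "integrable M (poly p)" for p :: "real poly"
        by (intro M.integrable_continuous continuous_on_poly continuous_on_id)
      then show ?thesis by (simp del: poly_mult poly_power poly_pCons)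
    qed
    also have "\<dots> = (norm u)\<^sup>2 - 4 * d\<^sup>2 * (lap u \<bullet> u)"
      unfolding spectral norm_fcalc[symmetric] X fcalc_sym[of q "lap u"] by (simp add: u_def)
    also have "\<dots> \<le> 2 / ?n\<^sup>2 * (norm (fcalc q ?h))\<^sup>2"
      using norm_fcalc_one_le[OF A u_def] by linarith
    also have "(norm (fcalc q ?h))\<^sup>2 = (norm ?h)\<^sup>2 * (\<integral>z. poly (q\<^sup>2) z \<partial>N)"
      by (simp only: N_spectral norm_fcalc)
    also have "2 / ?n\<^sup>2 * \<dots> = (\<integral>z. (poly q z)\<^sup>2 * (2 / ?n) \<partial>N)"
      unfolding norm_sum_delta[OF A(1)] using n by (simp add: power2_eq_square[of ?n])
    finally show "(\<integral>z. (poly q z)\<^sup>2 * (1 - 4 * d\<^sup>2 * z) \<partial>M) \<le> (\<integral>z. (poly q z)\<^sup>2 * (2 / ?n) \<partial>N)" .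
    show "0 \<le> ?g z" for z using E2 by (simp add: cts_step_def)
  qed (intro continuous_intros E2)+
  also have "\<dots> \<le> 2 / ?n"
  proof -
    have "(\<integral>z. ?g z \<partial>N) \<le> 1"
      using N.cdf_cts_step(2)[OF E2] N.cdf_bounded_prob[of "2 * E"] by linarith
    then show ?thesis using n by (simp add: divide_right_mono)
  qed
  finally have upper: "(\<integral>z. ?g z * (1 - 4 * d\<^sup>2 * z) \<partial>M) \<le> 2 / ?n" .
  have "(\<integral>z. ?g z * (1 / 2) \<partial>M) \<le> (\<integral>z. ?g z * (1 - 4 * d\<^sup>2 * z) \<partial>M)"
  proof (rule integral_mono)
    fix z
    show "?g z * (1 / 2) \<le> ?g z * (1 - 4 * d\<^sup>2 * z)"
    proof (cases "z \<le> 2 * E")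
      case True
      then have "4 * d\<^sup>2 * z \<le> 4 * d\<^sup>2 * (2 * E)" by (intro mult_left_mono) auto
      \<comment> \<open>On the support of the cut-off, \<open>4 d^2 z\<close> is at most
        \<open>8 d^2 E\<close>, which the assumption on \<open>E\<close> makes at most 1/2.\<close>
      then have "1 / 2 \<le> 1 - 4 * d\<^sup>2 * z" using E by linarith
      then show ?thesis using E2 by (intro mult_left_mono) (auto simp: cts_step_def)
    qed (use E2 in \<open>simp add: cts_step_def\<close>)
  qed (intro M.integrable_continuous continuous_intros E2)+
  moreover have "(\<integral>z. ?g z * (1 / 2) \<partial>M) = (\<integral>z. ?g z \<partial>M) / 2" by simp
  ultimately show ?thesis
    using M.cdf_cts_step(1)[OF E2] upper by linarith
qed

text \<open>The measure \<open>N\<close> of \<open>h\<close> is dominated by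
  \<open>card \<Omega>\<close> times \<open>M\<close>. Its mean is at most \<open>E / 4\<close>, so
  a Markov argument leaves at least half of its mass to the cut-off.\<close>

lemma cdf_ge_of_test_function:
  assumes \<Omega>: "finite \<Omega>" "\<Omega> \<subseteq> carrier G" "\<And>x. fval h x \<noteq> 0 \<Longrightarrow> x \<in> \<Omega>"
    and h: "h \<noteq> 0" "lap h \<bullet> h \<le> E / 4 * (norm h)\<^sup>2"
    and E: "0 < E"
  shows "1 / (2 * real (card \<Omega>)) \<le> cdf M E"
proof -
  let ?n = "real (card \<Omega>)" and ?g = "cts_step (E / 2) E"
  have E2: "E / 2 < E" using E by simp
  have norm_h: "0 < (norm h)\<^sup>2" using h by simp
  obtain x where "fval h x \<noteq> 0" using h(1) by (metis finsupp_eqI fval_simps(1))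
  then have n: "?n > 0" using \<Omega> by (auto simp: card_gt_0_iff)
  obtain N where N: "interval_distribution N (2 * real (card S))"
    and N_spectral: "\<And>p. (norm h)\<^sup>2 * (\<integral>z. poly p z \<partial>N) = fcalc p h \<bullet> h"
    using spectral_distribution by blast
  interpret N: interval_distribution N "2 * real (card S)" by (rule N)
  have "(\<integral>z. ?g z * 1 \<partial>N) \<le> (\<integral>z. ?g z * ?n \<partial>M)"
  proof (rule integral_le_of_poly_square[OF N M])
    fix q :: "real poly"
    have "(norm h)\<^sup>2 * (\<integral>z. poly (q\<^sup>2) z \<partial>N) \<le> (norm h)\<^sup>2 * (?n * (\<integral>z. poly (q\<^sup>2) z \<partial>M))"
      using norm_fcalc_le_support[OF \<Omega>, where q = q] unfolding N_spectral spectral norm_fcalc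
      by (simp only: mult.left_commute)
    then show "(\<integral>z. (poly q z)\<^sup>2 * 1 \<partial>N) \<le> (\<integral>z. (poly q z)\<^sup>2 * ?n \<partial>M)"
      using norm_h by (simp add: mult.commute)
    show "0 \<le> ?g z" for z using E2 by (simp add: cts_step_def)
  qed (intro continuous_intros E2)+
  also have "\<dots> \<le> ?n * cdf M E"
    using M.cdf_cts_step(2)[OF E2] n by (simp add: mult.commute)
  finally have upper: "(\<integral>z. ?g z \<partial>N) \<le> ?n * cdf M E" by simp
  have int_z: "(\<integral>z. z \<partial>N) \<le> E / 4"
  proof -
    have "(norm h)\<^sup>2 * (\<integral>z. z \<partial>N) = lap h \<bullet> h"
      using N_spectral[of "[:0, 1:]"] by (simp add: fcalc_X)
    also have "\<dots> \<le> (norm h)\<^sup>2 * (E / 4)" using h(2) by (simp add: mult.commute)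
    finally show ?thesis using norm_h by simp
  qed
  have "integrable N (\<lambda>z. z)" by (intro N.integrable_continuous continuous_intros)
  then have "1 - 2 / E * (\<integral>z. z \<partial>N) = (\<integral>z. 1 - 2 / E * z \<partial>N)"
    using N.prob_space by simp
  also have "\<dots> \<le> (\<integral>z. ?g z \<partial>N)"
  proof (rule integral_mono_AE)
    \<comment> \<open>The linear function is at most 1 for nonnegative \<open>z\<close> and
      nonpositive beyond \<open>E / 2\<close>, so it lies below the cut-off on the spectrum.\<close>
    show "AE z in N. 1 - 2 / E * z \<le> ?g z"
      using N.AE_interval
    proof eventually_elim
      case (elim z)
      show ?case
      proof (cases "z \<le> E / 2")
        case True
        then show ?thesis using elim E by (simp add: cts_step_def)
      next
        case False
        then have "1 - 2 / E * z \<le> 0" using E by (simp add: field_simps)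
        also have "0 \<le> ?g z" using E by (simp add: cts_step_def)
        finally show ?thesis .
      qed
    qed
  qed (intro N.integrable_continuous continuous_intros E2)+
  finally have "1 - 2 / E * (\<integral>z. z \<partial>N) \<le> (\<integral>z. ?g z \<partial>N)" .
  moreover have "2 / E * (\<integral>z. z \<partial>N) \<le> 2 / E * (E / 4)"
    using int_z E by (intro mult_left_mono) auto
  moreover have "2 / E * (E / 4) = 1 / 2" using E by simp
  ultimately have "1 / 2 \<le> ?n * cdf M E"
    using upper by linarith
  then show ?thesis using n by (simp add: field_simps)
qed

end

end

section \<open>The lamplighter group\<close>

definition LL_group :: "int \<Rightarrow> lamp monoid" where
  "LL_group m = \<lparr>carrier = LL_carrier m, mult = LL_mult m, one = LL_one\<rparr>"

lemma LL_group_simps [simp]: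
  "carrier (LL_group m) = LL_carrier m" "mult (LL_group m) = LL_mult m" "one (LL_group m) = LL_one"
  by (simp_all add: LL_group_def)

lemma finite_shifted_support:
  fixes f :: "int \<Rightarrow> int"
  assumes "finite {t. f t \<noteq> 0}"
  shows "finite {t. f (t + x) \<noteq> 0}"
  using finite_vimageI[OF assms, of "\<lambda>t. t + x"] by (simp add: vimage_def inj_def)

lemma LL_mult_closed:
  assumes "0 < m" "a \<in> LL_carrier m" "b \<in> LL_carrier m"
  shows "LL_mult m a b \<in> LL_carrier m"
proof -
  have "finite ({t. fst a t \<noteq> 0} \<union> {t. fst b (t + - snd a) \<noteq> 0})"
    using assms by (intro finite_UnI finite_shifted_support) (auto simp: LL_carrier_def)
  then have "finite {t. (fst a t + fst b (t - snd a)) mod m \<noteq> 0}"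
    by (rule finite_subset[rotated]) auto
  then show ?thesis
    using assms by (simp add: LL_carrier_def LL_mult_def)
qed

lemma LL_inv_closed:
  assumes "0 < m" "a \<in> LL_carrier m"
  shows "LL_inv m a \<in> LL_carrier m"
proof -
  have "finite {t. fst a (t + snd a) \<noteq> 0}"
    using assms by (intro finite_shifted_support) (auto simp: LL_carrier_def)
  then have "finite {t. (- fst a (t + snd a)) mod m \<noteq> 0}"
    by (rule finite_subset[rotated]) auto
  then show ?thesis
    using assms by (simp add: LL_carrier_def LL_inv_def)
qed

lemma LL_inv_mult: "LL_mult m (LL_inv m a) a = LL_one"
  by (simp add: LL_mult_def LL_inv_def LL_one_def mod_simps)

lemma group_LL_group:
  assumes "0 < m"
  shows "group (LL_group m)"
proof (rule groupI)
  fix a b c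
  show "\<one>\<^bsub>LL_group m\<^esub> \<in> carrier (LL_group m)"
    using assms by (simp add: LL_carrier_def LL_one_def)
  assume a: "a \<in> carrier (LL_group m)"
  then show "\<one>\<^bsub>LL_group m\<^esub> \<otimes>\<^bsub>LL_group m\<^esub> a = a"
    by (auto simp: LL_carrier_def LL_one_def LL_mult_def)
  show "\<exists>b\<in>carrier (LL_group m). b \<otimes>\<^bsub>LL_group m\<^esub> a = \<one>\<^bsub>LL_group m\<^esub>"
    using a LL_inv_closed[OF assms, of a] LL_inv_mult[of m a] by auto
  assume b: "b \<in> carrier (LL_group m)"
  then show "a \<otimes>\<^bsub>LL_group m\<^esub> b \<in> carrier (LL_group m)"
    using a assms by (simp add: LL_mult_closed)
  show "a \<otimes>\<^bsub>LL_group m\<^esub> b \<otimes>\<^bsub>LL_group m\<^esub> c = a \<otimes>\<^bsub>LL_group m\<^esub> (b \<otimes>\<^bsub>LL_group m\<^esub> c)"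
    by (simp add: LL_mult_def mod_simps algebra_simps)
qed

locale lamplighter =
  fixes m :: int and S :: "lamp set"
  assumes m: "m \<ge> 2"
    and finite: "finite S"
    and subset: "S \<subseteq> LL_carrier m"
    and inverse: "\<forall>s\<in>S. LL_inv m s \<in> S"
    and generates: "LL_gen m S = LL_carrier m"
begin

text \<open>\<open>walk\<close> and \<open>switch\<close> are the standard moves, a step to the
  right and an increment of the current lamp. They need not lie in \<open>S\<close>, but
  \<open>S\<close> generates them.\<close>

definition walk :: lamp where "walk = (\<lambda>_. 0, 1)"

definition switch :: lamp where "switch = (\<lambda>t. of_bool (t = 0), 0)"

lemma walk_closed: "walk \<in> LL_carrier m" and switch_closed: "switch \<in> LL_carrier m"
  using m by (auto simp: walk_def switch_def LL_carrier_def)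

lemma LL_inv_eq: "a \<in> LL_carrier m \<Longrightarrow> inv\<^bsub>LL_group m\<^esub> a = LL_inv m a"
  using m LL_inv_mult[of m a] LL_inv_closed[of m a]
  by (intro group.inv_equality[OF group_LL_group]) auto

sublocale cayley_graph "LL_group m" S
proof (intro cayley_graph.intro cayley_graph_axioms.intro)
  show "group (LL_group m)" using m by (simp add: group_LL_group)
  show "finite S" by (rule finite)
  show "S \<subseteq> carrier (LL_group m)" using subset by simp
  show "inv\<^bsub>LL_group m\<^esub> s \<in> S" if "s \<in> S" for s
    using that subset inverse LL_inv_eq[of s] by auto
  \<comment> \<open>An empty set would generate only the identity, and \<open>walk\<close> is
    another element.\<close>
  show "S \<noteq> {}"
  proof
    assume "S = {}"
    have "g = LL_one" if "g \<in> LL_gen m S" for g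
      using that by induction (simp_all add: \<open>S = {}\<close>)
    then have "walk = LL_one" using walk_closed generates by blast
    then show False by (simp add: walk_def LL_one_def)
  qed
qed

text \<open>\<open>LL_lap\<close> acts on functions on the whole type, \<open>lap\<close> vanishes
  off the carrier. They agree on the carrier because right multiplication by \<open>S\<close> never
  leaves it.\<close>

lemma LL_lap_power_eq:
  "g \<in> LL_carrier m \<Longrightarrow> (LL_lap m S ^^ n) LL_delta g = fval ((lap ^^ n) (delta LL_one)) g"
proof (induction n arbitrary: g)
  case (Suc n)
  have "LL_mult m g s \<in> LL_carrier m" if "s \<in> S" for s
    using that Suc.prems subset m by (intro LL_mult_closed) auto
  then show ?case
    using Suc by (simp add: LL_lap_def fval_lap)
qed (simp add: LL_delta_def)

lemma LL_moment_eq: "LL_moment m S n = (lap ^^ n) (delta LL_one) \<bullet> delta LL_one"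
  using one_closed by (simp add: LL_moment_def LL_lap_power_eq)

text \<open>Existence by \<open>spectral_distribution\<close> and uniqueness by determinacy of
  moments on a compact interval make the definite description denote.\<close>

lemma LL_spec_measure:
  shows interval_distribution_LL_spec_measure:
      "interval_distribution (LL_spec_measure m S) (2 * real (card S))"
    and LL_spec_measure_poly:
      "(\<integral>z. poly p z \<partial>LL_spec_measure m S) = fcalc p (delta LL_one) \<bullet> delta LL_one"
proof -
  let ?c = "2 * real (card S)"
  obtain M where M: "interval_distribution M ?c"
    and spectral': "\<And>p. (norm (delta LL_one))\<^sup>2 * (\<integral>z. poly p z \<partial>M) = fcalc p (delta LL_one) \<bullet> delta LL_one"
    using spectral_distribution by blast
  have spectral: "(\<integral>z. poly p z \<partial>M) = fcalc p (delta LL_one) \<bullet> delta LL_one" for p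
    using spectral'[of p] by simp
  interpret M: interval_distribution M ?c by (rule M)
  have moments: "(\<integral>z. z ^ n \<partial>M) = LL_moment m S n" for n
    using spectral[of "[:0, 1:] ^ n"] by (simp only: fcalc_power_X LL_moment_eq) simp
  have "LL_spec_measure m S = M"
    unfolding LL_spec_measure_def
  proof (rule the_equality)
    have "emeasure M (- {0..?c}) = 0"
      using M.AE_interval by (subst (asm) AE_iff_measurable[where N = "- {0..?c}"]) auto
    moreover have "integrable M (\<lambda>z. z ^ n)" for n
      by (intro M.integrable_continuous continuous_intros)
    ultimately show "sets M = sets borel \<and> finite_measure M \<and> emeasure M (- {0..?c}) = 0 \<and>
        (\<forall>n. integrable M (\<lambda>x. x ^ n) \<and> (\<integral>x. x ^ n \<partial>M) = LL_moment m S n)"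
      using moments M.finite_measure_axioms by simp
  next
    fix \<mu> assume \<mu>: "sets \<mu> = sets borel \<and> finite_measure \<mu> \<and> emeasure \<mu> (- {0..?c}) = 0 \<and>
        (\<forall>n. integrable \<mu> (\<lambda>x. x ^ n) \<and> (\<integral>x. x ^ n \<partial>\<mu>) = LL_moment m S n)"
    then interpret \<mu>: finite_measure \<mu> by blast
    have space: "space \<mu> = UNIV" using sets_eq_imp_space_eq[of \<mu> borel] \<mu> by simp
    \<comment> \<open>The zeroth moment turns an arbitrary finite measure into a probability, as the
      uniqueness lemma demands.\<close>
    have "(\<integral>x. x ^ 0 \<partial>\<mu>) = LL_moment m S 0" using \<mu> by blast
    then have "measure \<mu> (space \<mu>) = 1" by (simp add: LL_moment_eq)
    then have "prob_space \<mu>"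
      by (intro prob_spaceI) (simp add: \<mu>.emeasure_eq_measure)
    then have "real_distribution \<mu>"
      using \<mu> by (simp add: real_distribution_def real_distribution_axioms_def)
    moreover have "AE z in \<mu>. z \<in> {0..?c}"
      using \<mu> space by (subst AE_iff_measurable[where N = "- {0..?c}"]) auto
    ultimately have "interval_distribution \<mu> ?c"
      by (simp add: interval_distribution_def interval_distribution_axioms_def)
    then show "\<mu> = M"
      using \<mu> moments by (intro interval_distribution_eqI[OF _ M]) auto
  qed
  then show "interval_distribution (LL_spec_measure m S) ?c"
    and "(\<integral>z. poly p z \<partial>LL_spec_measure m S) = fcalc p (delta LL_one) \<bullet> delta LL_one"
    using M spectral by simp_all
qed

lemma LL_IDS_eq: "LL_IDS m S E = cdf (LL_spec_measure m S) E"
  by (simp add: LL_IDS_def cdf_def)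

section \<open>Exponentially many elements of linear displacement\<close>

lemma ex_displacement_le:
  assumes "g \<in> LL_carrier m"
  shows "\<exists>d. displacement_le g d"
proof -
  have "g \<in> LL_gen m S" using assms generates by simp
  then show ?thesis
  proof induction
    case one
    show ?case using displacement_le_one by auto
  next
    case (step g s)
    then obtain d where "displacement_le g d" by blast
    then show ?case
      using displacement_le_mult[of g s d 1] displacement_le_generator[of s] step generates subset by auto
  qed
qed

text \<open>The element reached by walking from 0 to \<open>n\<close> and lighting the lamps of
  \<open>X\<close> on the way.\<close>

definition indicator_lamp :: "nat \<Rightarrow> int set \<Rightarrow> lamp" where
  "indicator_lamp n X = (\<lambda>t. of_bool (t \<in> X), int n)"

lemma indicator_lamp_closed: "X \<subseteq> {0..<int n} \<Longrightarrow> indicator_lamp n X \<in> LL_carrier m"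
  using m by (auto simp: indicator_lamp_def LL_carrier_def intro: finite_subset[of _ "{0..<int n}"])

text \<open>Each of the \<open>n\<close> sites costs one \<open>walk\<close> and at most one
  \<open>switch\<close>, hence at most \<open>2 * d\<close>.\<close>

lemma displacement_indicator_lamp:
  assumes "displacement_le walk d" "displacement_le switch d" "X \<subseteq> {0..<int n}"
  shows "displacement_le (indicator_lamp n X) (2 * d * real n)"
  using assms(3)
proof (induction n arbitrary: X)
  case 0
  then show ?case
    using displacement_le_one by (simp add: indicator_lamp_def LL_one_def)
next
  case (Suc n)
  have d: "0 \<le> d" using assms(1) by (simp add: displacement_le_def)
  \<comment> \<open>After \<open>n\<close> steps the lamplighter stands at site \<open>n\<close>, so
    lamp \<open>n\<close> is the one that the last step can light.\<close>
  let ?Y = "X \<inter> {0..<int n}"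
  let ?g = "indicator_lamp n ?Y"
  have g: "?g \<in> LL_carrier m" "displacement_le ?g (2 * d * real n)"
    using indicator_lamp_closed[of ?Y n] Suc.IH[of ?Y] by auto
  have X: "t \<in> X \<longleftrightarrow> t \<in> ?Y \<or> t = int n \<and> int n \<in> X" for t
    using Suc.prems by (cases "t = int n") force+
  show ?case
  proof (cases "int n \<in> X")
    case True
    have 1: "displacement_le (LL_mult m ?g switch) (2 * d * real n + d)"
      using displacement_le_mult[OF _ _ g(2) assms(2)] g(1) switch_closed by simp
    have "displacement_le (LL_mult m (LL_mult m ?g switch) walk) (2 * d * real n + d + d)"
      using displacement_le_mult[OF _ _ 1 assms(1)] g(1) switch_closed walk_closed m
      by (simp add: LL_mult_closed)
    moreover have "LL_mult m (LL_mult m ?g switch) walk = indicator_lamp (Suc n) X"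
    proof (rule prod_eqI[OF ext])
      show "fst (LL_mult m (LL_mult m ?g switch) walk) t = fst (indicator_lamp (Suc n) X) t" for t
        using m True X[of t]
        by (cases "t = int n") (simp_all add: indicator_lamp_def LL_mult_def switch_def walk_def)
    qed (simp add: indicator_lamp_def LL_mult_def switch_def walk_def)
    ultimately show ?thesis by (simp add: algebra_simps)
  next
    case False
    have "displacement_le (LL_mult m ?g walk) (2 * d * real n + d)"
      using displacement_le_mult[OF _ _ g(2) assms(1)] g(1) walk_closed by simp
    moreover have "LL_mult m ?g walk = indicator_lamp (Suc n) X"
    proof (rule prod_eqI[OF ext])
      show "fst (LL_mult m ?g walk) t = fst (indicator_lamp (Suc n) X) t" for t
        using m False X[of t]
        by (cases "t = int n") (simp_all add: indicator_lamp_def LL_mult_def walk_def)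
    qed (simp add: indicator_lamp_def LL_mult_def walk_def)
    moreover have "2 * d * real n + d \<le> 2 * d * real (Suc n)"
      using d by (simp add: algebra_simps)
    ultimately show ?thesis using displacement_le_mono by metis
  qed
qed

lemma card_indicator_lamps: "card (indicator_lamp n ` Pow {0..<int n}) = 2 ^ n"
proof -
  have "inj (indicator_lamp n)"
    by (auto simp: inj_def indicator_lamp_def fun_eq_iff of_bool_eq_iff)
  then show ?thesis
    by (subst card_image) (auto simp: card_Pow intro: inj_on_subset)
qed

lemma LL_IDS_upper:
  "\<exists>a1>0. \<exists>a2>0. \<forall>E>0. LL_IDS m S E \<le> a1 * exp (- a2 * E powr (-1/2))"
proof -
  obtain d1 d2 where "displacement_le walk d1" "displacement_le switch d2"
    using ex_displacement_le walk_closed switch_closed by blast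
  \<comment> \<open>One constant for both moves, kept at least 1 so that it can be divided
    by.\<close>
  then have "displacement_le walk (max 1 (max d1 d2))" "displacement_le switch (max 1 (max d1 d2))"
    by (auto elim!: displacement_le_mono)
  then obtain d where d: "displacement_le walk d" "displacement_le switch d" "1 \<le> d"
    using max.cobounded1 by blast
  have "LL_IDS m S E \<le> 8 * exp (- (ln 2 / (8 * d)) * E powr (-1/2))" if E: "0 < E" for E
  proof -
    \<comment> \<open>With displacement \<open>2 * d * n\<close> the condition of
      \<open>cdf_le_of_displacement\<close> reads \<open>64 d^2 n^2 E \<le> 1\<close>, that is
      \<open>8 d n \<le> E^(-1/2)\<close>; \<open>n\<close> is the largest such integer.\<close>
    define n where "n = nat \<lfloor>E powr (-1/2) / (8 * d)\<rfloor>"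
    have quot: "0 \<le> E powr (-1/2) / (8 * d)" using d by simp
    then have n: "real n \<le> E powr (-1/2) / (8 * d)" "E powr (-1/2) / (8 * d) \<le> real n + 1"
      unfolding n_def by linarith+
    have "real n * (8 * d) \<le> E powr (-1/2)" using n(1) d by (simp add: field_simps)
    then have "(real n * (8 * d))\<^sup>2 \<le> (E powr (-1/2))\<^sup>2" using d by (intro power_mono) auto
    also have "(E powr (-1/2))\<^sup>2 = 1 / E"
      using E by (simp add: power2_eq_square powr_minus_divide flip: powr_add)
    finally have "(real n * (8 * d))\<^sup>2 * E \<le> 1" using E by (simp add: field_simps)
    then have "16 * (2 * d * real n)\<^sup>2 * E \<le> 1" by (simp add: power2_eq_square algebra_simps)
    then have "LL_IDS m S E \<le> 4 / real (card (indicator_lamp n ` Pow {0..<int n}))"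
      unfolding LL_IDS_eq using E d indicator_lamp_closed displacement_indicator_lamp
      by (intro cdf_le_of_displacement[OF interval_distribution_LL_spec_measure _ _ _ _ _ E])
         (auto simp: LL_spec_measure_poly)
    also have "\<dots> = 4 * exp (- (ln 2 * real n))"
      by (simp add: card_indicator_lamps exp_minus exp_of_nat_mult divide_inverse mult.commute[of "ln 2"])
    \<comment> \<open>Rounding down loses at most 1 in \<open>n\<close>, a factor 2, which turns 4
      into 8.\<close>
    also have "\<dots> \<le> 4 * exp (- (ln 2 * (E powr (-1/2) / (8 * d) - 1)))"
      using n(2) by simp
    also have "\<dots> = 8 * exp (- (ln 2 / (8 * d)) * E powr (-1/2))"
      by (simp add: right_diff_distrib exp_diff exp_minus field_simps)
    finally show ?thesis .
  qed
  moreover have "0 < ln 2 / (8 * d)" using d by simp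
  ultimately show ?thesis by (intro exI[of _ 8] exI[of _ "ln 2 / (8 * d)"] conjI) auto
qed

end

section \<open>Tent functions over a box of lamps\<close>

definition box_configs :: "int \<Rightarrow> int \<Rightarrow> (int \<Rightarrow> int) set" where
  "box_configs m r = {\<phi>. (\<forall>t. 0 \<le> \<phi> t \<and> \<phi> t < m) \<and> (\<forall>t. \<phi> t \<noteq> 0 \<longrightarrow> \<bar>t\<bar> \<le> r)}"

lemma box_configs_finite: "finite (box_configs m r)"
  and card_box_configs_le: "0 < m \<Longrightarrow> 0 \<le> r \<Longrightarrow> card (box_configs m r) \<le> nat m ^ nat (2 * r + 1)"
proof -
  let ?I = "{-r..r}"
  have inj: "inj_on (\<lambda>\<phi>. restrict \<phi> ?I) (box_configs m r)"
  proof (rule inj_onI, rule ext)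
    fix \<phi> \<psi> t
    assume *: "\<phi> \<in> box_configs m r" "\<psi> \<in> box_configs m r" "restrict \<phi> ?I = restrict \<psi> ?I"
    show "\<phi> t = \<psi> t"
    proof (cases "t \<in> ?I")
      case True
      then show ?thesis using fun_cong[OF *(3), of t] by simp
    next
      case False
      then have "\<not> \<bar>t\<bar> \<le> r" by auto
      then show ?thesis using * unfolding box_configs_def by (metis (mono_tags, lifting) mem_Collect_eq)
    qed
  qed
  have sub: "(\<lambda>\<phi>. restrict \<phi> ?I) ` box_configs m r \<subseteq> (\<Pi>\<^sub>E t\<in>?I. {0..<m})"
    by (auto simp: box_configs_def)
  have fin: "finite (\<Pi>\<^sub>E t\<in>?I. {0..<m})" by (intro finite_PiE) auto
  show "finite (box_configs m r)"
    using inj sub fin by (rule inj_on_finite)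
  show "card (box_configs m r) \<le> nat m ^ nat (2 * r + 1)" if "0 < m" "0 \<le> r"
  proof -
    have "card (box_configs m r) \<le> card (\<Pi>\<^sub>E t\<in>?I. {0..<m})"
      by (rule card_inj_on_le[OF inj sub fin])
    also have "\<dots> = nat m ^ nat (2 * r + 1)"
      by (subst card_PiE) (auto simp: algebra_simps)
    finally show ?thesis .
  qed
qed

lemma box_configs_card_pos: "0 < m \<Longrightarrow> 0 < card (box_configs m r)"
proof -
  assume "0 < m"
  then have "(\<lambda>_. 0) \<in> box_configs m r" by (simp add: box_configs_def)
  then show ?thesis by (auto simp: card_gt_0_iff box_configs_finite)
qed

lemma box_configs_imp_LL_carrier:
  assumes "\<phi> \<in> box_configs m r"
  shows "(\<phi>, x) \<in> LL_carrier m"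
proof -
  have "{t. \<phi> t \<noteq> 0} \<subseteq> {-r..r}"
    using assms by (fastforce simp: box_configs_def)
  then have "finite {t. \<phi> t \<noteq> 0}" by (rule finite_subset) simp
  then show ?thesis using assms by (simp add: box_configs_def LL_carrier_def)
qed

definition tent :: "int \<Rightarrow> int \<Rightarrow> real" where
  "tent n x = real_of_int (max 0 (n - \<bar>x\<bar>))"

lemma tent_lipschitz: "\<bar>tent n x - tent n (x + y)\<bar> \<le> \<bar>real_of_int y\<bar>"
  unfolding tent_def by linarith

text \<open>Constant in the lamps within the box, so that switching there costs no energy; only the
  position of the lamplighter is cut off.\<close>

definition tent_function :: "int \<Rightarrow> int \<Rightarrow> int \<Rightarrow> lamp finsupp" where
  "tent_function m r n = (\<Sum>g\<in>box_configs m r \<times> {-n..n}. tent n (snd g) *\<^sub>R delta g)"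

lemma fval_tent_function:
  "fval (tent_function m r n) g = (if fst g \<in> box_configs m r then tent n (snd g) else 0)"
proof -
  have "fval (tent_function m r n) g =
      (\<Sum>g'\<in>box_configs m r \<times> {-n..n}. if g' = g then tent n (snd g) else 0)"
    by (auto simp: tent_function_def intro!: sum.cong)
  also have "\<dots> = (if g \<in> box_configs m r \<times> {-n..n} then tent n (snd g) else 0)"
    by (simp add: box_configs_finite)
  also have "\<dots> = (if fst g \<in> box_configs m r then tent n (snd g) else 0)"
    by (cases g) (auto simp: tent_def)
  finally show ?thesis .
qed

text \<open>A tent of half-width \<open>2 * p\<close> is at least \<open>p\<close> at the
  \<open>2 * p + 1\<close> central positions, so its square sums to order \<open>p^3\<close> for
  each configuration.\<close>

lemma norm_tent_function_ge:
  "real (card (box_configs m r)) * (2 * real p ^ 3) \<le> (norm (tent_function m r (2 * int p)))\<^sup>2"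
proof -
  let ?F = "box_configs m r" and ?h = "tent_function m r (2 * int p)"
  have "?h \<bullet> ?h = (\<Sum>g\<in>?F \<times> {-(2 * int p)..2 * int p}. fval ?h g * fval ?h g)"
    by (rule inner_finsupp_eq_sum) (auto simp: box_configs_finite fval_tent_function tent_def split: if_splits)
  also have "\<dots> \<ge> (\<Sum>g\<in>?F \<times> {-int p..int p}. fval ?h g * fval ?h g)"
    by (rule sum_mono2) (auto simp: box_configs_finite)
  also have "(\<Sum>g\<in>?F \<times> {-int p..int p}. fval ?h g * fval ?h g) \<ge> (\<Sum>g\<in>?F \<times> {-int p..int p}. real p * real p)"
  proof (rule sum_mono)
    fix g assume g: "g \<in> ?F \<times> {-int p..int p}"
    then have "real p \<le> fval ?h g"
      by (auto simp: fval_tent_function tent_def)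
    then show "real p * real p \<le> fval ?h g * fval ?h g"
      by (intro mult_mono) auto
  qed
  moreover have "(\<Sum>g\<in>?F \<times> {-int p..int p}. real p * real p)
      = real (card ?F) * ((2 * real p + 1) * (real p * real p))"
    by (simp add: card_cartesian_product nat_add_distrib nat_mult_distrib algebra_simps)
  moreover have "real (card ?F) * (2 * real p ^ 3) \<le> real (card ?F) * ((2 * real p + 1) * (real p * real p))"
    by (intro mult_left_mono) (auto simp: power3_eq_cube algebra_simps)
  ultimately show ?thesis unfolding power2_norm_eq_inner by linarith
qed

text \<open>A change confined to the box leaves the lamps outside as they are, and membership
  depends only on those.\<close>

lemma mult_in_box_configs_iff:
  assumes "\<forall>t. 0 \<le> \<phi> t \<and> \<phi> t < (m::int)" "\<And>t. \<psi> (t - x) \<noteq> 0 \<Longrightarrow> \<bar>t\<bar> \<le> r"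
  shows "(\<lambda>t. (\<phi> t + \<psi> (t - x)) mod m) \<in> box_configs m r \<longleftrightarrow> \<phi> \<in> box_configs m r"
proof -
  have m: "0 < m" using assms(1) by (metis le_less_trans)
  have "(\<phi> t + \<psi> (t - x)) mod m = \<phi> t" if "\<not> \<bar>t\<bar> \<le> r" for t
  proof -
    have "\<psi> (t - x) = 0" using assms(2)[of t] that by blast
    then show ?thesis using assms(1) by simp
  qed
  then have "(\<forall>t. (\<phi> t + \<psi> (t - x)) mod m \<noteq> 0 \<longrightarrow> \<bar>t\<bar> \<le> r) \<longleftrightarrow> (\<forall>t. \<phi> t \<noteq> 0 \<longrightarrow> \<bar>t\<bar> \<le> r)"
    by metis
  then show ?thesis
    using assms(1) m by (simp add: box_configs_def)
qed

section \<open>Rayleigh quotient of the tent and the resulting lower bound\<close>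

context lamplighter
begin

text \<open>Within the margin \<open>2D\<close>, a generator applied at a position where the tent does not vanish can
  only touch lamps inside the box.\<close>

lemma gradient_tent_function:
  assumes s: "s \<in> S" "\<bar>snd s\<bar> \<le> D" "\<And>t. fst s t \<noteq> 0 \<Longrightarrow> \<bar>t\<bar> \<le> D" and n: "0 \<le> n"
  defines "F \<equiv> box_configs m (n + 2 * D)" and "h \<equiv> tent_function m (n + 2 * D) n"
  shows "(norm (P h - R s h))\<^sup>2 \<le> real (card F) * real_of_int (2 * (n + D) + 1) * (real_of_int D)\<^sup>2"
proof -
  let ?X = "F \<times> {-(n + D)..n + D}"
  have D: "0 \<le> D" using s(2) by linarith
  have s_carrier: "s \<in> carrier (LL_group m)" using s(1) by (rule S_in_carrier)
  have diff: "\<bar>fval (P h - R s h) g\<bar> \<le> real_of_int D \<and> (fval (P h - R s h) g \<noteq> 0 \<longrightarrow> g \<in> ?X)" for g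
  proof (cases "g \<in> LL_carrier m")
    case False
    then show ?thesis using D s_carrier by (simp add: fval_R)
  next
    case True
    obtain \<phi> x where g: "g = (\<phi>, x)" by (cases g)
    let ?\<phi>' = "\<lambda>t. (\<phi> t + fst s (t - x)) mod m"
    have val: "fval (P h - R s h) g
        = (if \<phi> \<in> F then tent n x else 0) - (if ?\<phi>' \<in> F then tent n (x + snd s) else 0)"
      using True s_carrier by (simp add: fval_R h_def F_def fval_tent_function g LL_mult_def)
    show ?thesis
    proof (cases "\<bar>x\<bar> \<le> n + D")
      case True
      have "\<bar>t\<bar> \<le> n + 2 * D" if "fst s (t - x) \<noteq> 0" for t
        using s(3)[OF that] True by linarith
      then have "?\<phi>' \<in> F \<longleftrightarrow> \<phi> \<in> F"
        unfolding F_def using \<open>g \<in> LL_carrier m\<close> by (intro mult_in_box_configs_iff) (auto simp: g LL_carrier_def)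
      moreover have "\<bar>tent n x - tent n (x + snd s)\<bar> \<le> real_of_int D"
        using tent_lipschitz[of n x "snd s"] s(2) by linarith
      ultimately show ?thesis
        using val True D by (auto simp: g)
    next
      case False
      \<comment> \<open>A move shifts the position by at most \<open>D\<close>, so from beyond
        \<open>n + D\<close> both positions lie outside the tent, whatever happens to the
        lamps.\<close>
      then have "tent n x = 0" "tent n (x + snd s) = 0"
        using s(2) D n by (auto simp: tent_def)
      then show ?thesis using val D by simp
    qed
  qed
  have fin: "finite ?X" by (simp add: F_def box_configs_finite)
  have "(norm (P h - R s h))\<^sup>2 = (\<Sum>g\<in>?X. (fval (P h - R s h) g)\<^sup>2)"
    unfolding power2_norm_eq_inner power2_eq_square[of "fval _ _"]
    using diff by (intro inner_finsupp_eq_sum fin) blast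
  also have "\<dots> \<le> (\<Sum>g\<in>?X. (real_of_int D)\<^sup>2)"
    using diff D by (intro sum_mono) (metis abs_le_square_iff abs_of_nonneg of_int_0_le_iff)
  also have "\<dots> = real (card F) * real_of_int (2 * (n + D) + 1) * (real_of_int D)\<^sup>2"
    using n D by (simp add: card_cartesian_product)
  finally show ?thesis .
qed

text \<open>For each configuration the gradient energy is of order \<open>p\<close> and the squared
  norm of order \<open>p^3\<close>, so the quotient is of order \<open>p^(-2)\<close>; the second
  condition on \<open>E\<close> makes it small enough.\<close>

lemma tent_function_rayleigh:
  assumes D: "1 \<le> D" "\<And>s. s \<in> S \<Longrightarrow> \<bar>snd s\<bar> \<le> D" "\<And>s t. s \<in> S \<Longrightarrow> fst s t \<noteq> 0 \<Longrightarrow> \<bar>t\<bar> \<le> D"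
    and p: "1 \<le> p" and E: "0 < E"
      "real (card S) * (real_of_int D)\<^sup>2 * (5 + 2 * real_of_int D) \<le> E * (real p)\<^sup>2"
  defines "h \<equiv> tent_function m (2 * int p + 2 * D) (2 * int p)"
  shows "lap h \<bullet> h \<le> E / 4 * (norm h)\<^sup>2"
proof -
  let ?N = "real (card (box_configs m (2 * int p + 2 * D)))" and ?D = "real_of_int D"
  have "2 * (lap h \<bullet> h) \<le> (\<Sum>s\<in>S. ?N * real_of_int (2 * (2 * int p + D) + 1) * ?D\<^sup>2)"
    unfolding sum_norm_gradient[symmetric] h_def
    using D by (intro sum_mono gradient_tent_function) auto
  also have "\<dots> = ?N * (real (card S) * ?D\<^sup>2 * (4 * real p + 2 * ?D + 1))"
    by (simp add: algebra_simps)
  also have "\<dots> \<le> ?N * (real (card S) * ?D\<^sup>2 * ((5 + 2 * ?D) * real p))"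
  proof -
    \<comment> \<open>Since \<open>p\<close> is at least 1, the constant \<open>2 D + 1\<close> is
      absorbed into a multiple of \<open>p\<close>.\<close>
    have "4 * real p + 2 * ?D + 1 \<le> (5 + 2 * ?D) * real p"
      using p D(1) mult_right_mono[of 1 "real p" "2 * ?D + 1"] by (simp add: algebra_simps)
    then show ?thesis by (intro mult_left_mono) auto
  qed
  also have "\<dots> = ?N * real p * (real (card S) * ?D\<^sup>2 * (5 + 2 * ?D))" by (simp add: algebra_simps)
  also have "\<dots> \<le> ?N * real p * (E * (real p)\<^sup>2)"
    using E(2) by (intro mult_left_mono) auto
  also have "\<dots> = E / 2 * (?N * (2 * real p ^ 3))"
    by (simp add: power2_eq_square power3_eq_cube)
  also have "\<dots> \<le> E / 2 * (norm h)\<^sup>2"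
    unfolding h_def using E by (intro mult_left_mono norm_tent_function_ge) auto
  finally show ?thesis by simp
qed

text \<open>There are at most \<open>m^(4p + 4D + 1)\<close> configurations and
  \<open>4p + 1 \<le> e^(4p)\<close> positions, so the size is exponential in
  \<open>p\<close>.\<close>

lemma card_support_le:
  assumes "0 \<le> D"
  shows "real (card (box_configs m (2 * int p + 2 * D) \<times> {-(2 * int p)..2 * int p}))
    \<le> exp ((4 * real_of_int D + 1) * ln (real_of_int m) + 4 * (ln (real_of_int m) + 1) * real p)"
proof -
  have "real (card (box_configs m (2 * int p + 2 * D))) \<le> real (nat m ^ nat (2 * (2 * int p + 2 * D) + 1))"
    using m assms by (intro of_nat_mono card_box_configs_le) auto
  also have "\<dots> = exp (ln (real_of_int m)) ^ nat (2 * (2 * int p + 2 * D) + 1)"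
    using m by simp
  also have "\<dots> = exp (real (nat (2 * (2 * int p + 2 * D) + 1)) * ln (real_of_int m))"
    by (simp only: exp_of_nat_mult)
  also have "real (nat (2 * (2 * int p + 2 * D) + 1)) = 4 * real p + 4 * real_of_int D + 1"
    using assms by simp
  finally have 1: "real (card (box_configs m (2 * int p + 2 * D)))
    \<le> exp ((4 * real p + 4 * real_of_int D + 1) * ln (real_of_int m))" .
  have 2: "real (card {-(2 * int p)..2 * int p}) \<le> exp (4 * real p)"
    using exp_ge_add_one_self[of "4 * real p"] by (simp add: add.commute)
  have "real (card (box_configs m (2 * int p + 2 * D) \<times> {-(2 * int p)..2 * int p}))
      \<le> exp ((4 * real p + 4 * real_of_int D + 1) * ln (real_of_int m)) * exp (4 * real p)"
    unfolding card_cartesian_product of_nat_mult by (intro mult_mono 1 2) auto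
  then show ?thesis by (simp add: algebra_simps flip: exp_add)
qed

lemma LL_IDS_lower:
  "\<exists>a1>0. \<exists>a2>0. \<forall>E>0. a1 * exp (- a2 * E powr (-1/2)) \<le> LL_IDS m S E"
proof -
  let ?W = "snd ` S \<union> (\<Union>s\<in>S. {t. fst s t \<noteq> 0})"
  have "finite ?W"
    using finite subset by (auto simp: LL_carrier_def split_beta)
  then have "finite (abs ` insert 1 ?W)" by simp
  \<comment> \<open>\<open>D\<close> bounds the shift and the reach of every generator; the inserted
    1 gives \<open>D \<ge> 1\<close>.\<close>
  define D where "D = Max (abs ` insert 1 ?W)"
  have le_D: "\<bar>w\<bar> \<le> D" if "w \<in> insert 1 ?W" for w
    unfolding D_def using \<open>finite (abs ` insert 1 ?W)\<close> that by (intro Max_ge) auto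
  have D: "1 \<le> D" "\<And>s. s \<in> S \<Longrightarrow> \<bar>snd s\<bar> \<le> D" "\<And>s t. s \<in> S \<Longrightarrow> fst s t \<noteq> 0 \<Longrightarrow> \<bar>t\<bar> \<le> D"
    using le_D[of 1] by (auto intro!: le_D)
  define K where "K = real (card S) * (real_of_int D)\<^sup>2 * (5 + 2 * real_of_int D)"
  have K: "0 < K"
    unfolding K_def using D(1) S_nonempty by (intro mult_pos_pos) (auto simp: card_gt_0_iff)
  define l where "l = ln (real_of_int m)"
  have l: "0 < l" using m by (simp add: l_def)
  define b where "b = (4 * real_of_int D + 1) * l"
  have "1 / 2 * exp (- b - 8 * (l + 1)) * exp (- (4 * (l + 1) * sqrt K) * E powr (-1/2)) \<le> LL_IDS m S E"
    if E: "0 < E" for E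
  proof -
    let ?q = "sqrt K * E powr (-1/2)"
    \<comment> \<open>The Rayleigh bound asks for \<open>K \<le> E p^2\<close>, so \<open>p\<close>
      is \<open>sqrt (K / E)\<close> rounded up; the added 1 keeps it positive. The excess over
      \<open>?q\<close> is at most 2 and accounts for the term \<open>8 * (l + 1)\<close> in the
      constant.\<close>
    define p where "p = nat \<lceil>?q\<rceil> + 1"
    have q: "0 \<le> ?q" using K by simp
    then have p: "1 \<le> p" "?q \<le> real p" "real p \<le> ?q + 2"
      unfolding p_def by linarith+
    let ?h = "tent_function m (2 * int p + 2 * D) (2 * int p)"
    let ?\<Omega> = "box_configs m (2 * int p + 2 * D) \<times> {-(2 * int p)..2 * int p}"
    have "(E powr (-1/2))\<^sup>2 = 1 / E"
      using E by (simp add: power2_eq_square powr_minus_divide flip: powr_add)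
    then have "?q\<^sup>2 = K / E" using K by (simp add: power_mult_distrib)
    moreover have "?q\<^sup>2 \<le> (real p)\<^sup>2" using p q by (intro power_mono) auto
    ultimately have "K / E \<le> (real p)\<^sup>2" by simp
    then have "K \<le> E * (real p)\<^sup>2" using E by (simp add: pos_divide_le_eq mult.commute)
    then have rayleigh: "lap ?h \<bullet> ?h \<le> E / 4 * (norm ?h)\<^sup>2"
      unfolding K_def by (intro tent_function_rayleigh D p(1) E)
    have "0 < real (card (box_configs m (2 * int p + 2 * D))) * (2 * real p ^ 3)"
      using box_configs_card_pos[of m "2 * int p + 2 * D"] m p(1) by simp
    also have "\<dots> \<le> (norm ?h)\<^sup>2" by (rule norm_tent_function_ge)
    finally have nz: "?h \<noteq> 0" by auto
    have "finite ?\<Omega>" by (simp add: box_configs_finite)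
    moreover have "?\<Omega> \<subseteq> carrier (LL_group m)"
      by (auto intro: box_configs_imp_LL_carrier)
    moreover have "x \<in> ?\<Omega>" if "fval ?h x \<noteq> 0" for x
      using that by (cases x) (auto simp: fval_tent_function tent_def split: if_splits)
    ultimately have "1 / (2 * real (card ?\<Omega>)) \<le> cdf (LL_spec_measure m S) E"
      by (intro cdf_ge_of_test_function[OF interval_distribution_LL_spec_measure _ _ _ _ nz rayleigh E])
         (auto simp: LL_spec_measure_poly)
    then have "1 / (2 * real (card ?\<Omega>)) \<le> LL_IDS m S E"
      by (simp only: LL_IDS_eq)
    moreover have "1 / 2 * exp (- b - 8 * (l + 1)) * exp (- (4 * (l + 1) * sqrt K) * E powr (-1/2))
        \<le> 1 / (2 * real (card ?\<Omega>))"
    proof -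
      have "4 * (l + 1) * real p \<le> 4 * (l + 1) * (?q + 2)"
        using p(3) l by (intro mult_left_mono) auto
      then have "- b - 8 * (l + 1) + - (4 * (l + 1) * sqrt K) * E powr (-1/2) \<le> - (b + 4 * (l + 1) * real p)"
        by (simp add: algebra_simps)
      then have "exp (- b - 8 * (l + 1)) * exp (- (4 * (l + 1) * sqrt K) * E powr (-1/2))
          \<le> exp (- (b + 4 * (l + 1) * real p))"
        unfolding exp_add[symmetric] by simp
      also have "\<dots> \<le> 1 / real (card ?\<Omega>)"
      proof -
        have "0 < card ?\<Omega>"
          using box_configs_card_pos[of m "2 * int p + 2 * D"] m by (simp add: card_cartesian_product)
        moreover have "real (card ?\<Omega>) \<le> exp (b + 4 * (l + 1) * real p)"
          unfolding b_def l_def using D(1) by (intro card_support_le) simp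
        ultimately have "inverse (exp (b + 4 * (l + 1) * real p)) \<le> inverse (real (card ?\<Omega>))"
          by (intro le_imp_inverse_le) simp_all
        then show ?thesis by (simp only: exp_minus inverse_eq_divide)
      qed
      finally show ?thesis by simp
    qed
    ultimately show ?thesis by linarith
  qed
  moreover have "0 < 4 * (l + 1) * sqrt K" using l K by simp
  ultimately show ?thesis
    by (intro exI[of _ "1 / 2 * exp (- b - 8 * (l + 1))"] exI[of _ "4 * (l + 1) * sqrt K"] conjI) auto
qed

end

theorem theorem3p7:
  fixes m :: int and S :: "lamp set"
  assumes "m \<ge> 2"
    and "finite S"
    and "S \<subseteq> LL_carrier m"
    and "\<forall>s\<in>S. LL_inv m s \<in> S"
    and "LL_one \<notin> S"
    and "LL_gen m S = LL_carrier m"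
  shows "(\<exists>a1>0. \<exists>a2>0. \<forall>\<^sub>F E in at_right (0::real).
            LL_IDS m S E \<le> a1 * exp (- a2 * E powr (-1/2)))
       \<and> (\<forall>r::real. r > 1/2 \<longrightarrow> (\<exists>a1>0. \<exists>a2>0. \<forall>\<^sub>F E in at_right (0::real).
            LL_IDS m S E \<ge> a1 * exp (- a2 * E powr (- r))))"
proof (intro conjI allI impI)
  interpret lamplighter m S using assms by unfold_locales
  obtain a1 a2 where "a1 > 0" "a2 > 0" "\<forall>E>0. LL_IDS m S E \<le> a1 * exp (- a2 * E powr (-1/2))"
    using LL_IDS_upper by blast
  then show "\<exists>a1>0. \<exists>a2>0. \<forall>\<^sub>F E in at_right (0::real).
      LL_IDS m S E \<le> a1 * exp (- a2 * E powr (-1/2))"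
    by (intro exI[of _ a1] exI[of _ a2] conjI) (auto simp: eventually_at_filter)
  fix r :: real assume r: "r > 1/2"
  obtain b1 b2 where b: "b1 > 0" "b2 > 0" "\<forall>E>0. b1 * exp (- b2 * E powr (-1/2)) \<le> LL_IDS m S E"
    using LL_IDS_lower by blast
  have "b1 * exp (- b2 * E powr (- r)) \<le> LL_IDS m S E" if "0 < E" "E < 1" for E
  proof -
    \<comment> \<open>For \<open>E < 1\<close> the larger exponent \<open>r\<close> gives the larger
      power, so the bound with exponent 1/2 is the stronger one.\<close>
    have "E powr (-1/2) \<le> E powr (- r)"
      using that r by (intro powr_mono') auto
    then have "b1 * exp (- b2 * E powr (- r)) \<le> b1 * exp (- b2 * E powr (-1/2))"
      using b by simp
    also have "\<dots> \<le> LL_IDS m S E" using b that by blast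
    finally show ?thesis .
  qed
  then have "\<forall>\<^sub>F E in at_right (0::real). b1 * exp (- b2 * E powr (- r)) \<le> LL_IDS m S E"
    using eventually_at_right_less[of "0::real"] eventually_at_right[of 0 "1::real"]
    by (auto simp: eventually_at_right[of 0 "1::real"] intro!: exI[of _ 1])
  then show "\<exists>a1>0. \<exists>a2>0. \<forall>\<^sub>F E in at_right (0::real). LL_IDS m S E \<ge> a1 * exp (- a2 * E powr (- r))"
    using b by blast
qed

end
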